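(* Let $q$ be a prime power and $d\geq 0$ an integer. Then, as formal power series in $t$ (with coefficients polynomial in $q$), $$\sum_{F\in \mathcal{WF}(\mathbb F_q^d)}t^{w(F)}=M_d\prod_{j=1}^d\frac{1}{1-t^j},\qquad\text{where } M_d=\sum_{\sigma\in \mathcal S_d}q^{\mathrm{inv}(\sigma)}t^{\mathrm{maj}(\sigma)} .$$
   Context: A (partial) flag of a finite-dimensional vector space $V$ is a sequence $V_1\subset V_2\subset\dots\subset V_k$ of subspaces of $V$ with $0<\dim V_1<\dim V_2<\dots<\dim V_k\leq \dim V$ ($k\ge 0$; the case $k=0$ is the empty flag; $V_k=V$ is allowed). A weighted flag is a flag $V_1\subset\dots\subset V_k$ together with strictly positive integers $w_1,\dots,w_k$; its weight is $w(F)=\sum_{i=1}^k w_i\dim(V_i)$. $\mathcal{WF}(V)$ denotes the set of all weighted flags of $V$. For a permutation $\sigma$ of $\{1,\dots,d\}$, $\mathrm{inv}(\sigma)$ is the number of pairs $i<j$ with $\sigma(i)>\sigma(j)$, and $\mathrm{maj}(\sigma)=\sum_{1\le i<d,\ \sigma(i)>\sigma(i+1)} i$ is the major index. *)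

theory Defs
  imports
    "Jordan_Normal_Form.VS_Connect"
    "HOL-Analysis.Infinite_Sum"
    "HOL-Computational_Algebra.Formal_Power_Series"
    "HOL-Combinatorics.Permutations"
    "HOL-Number_Theory.Prime_Powers"
begin

definition subspace_dim ::
  "('a, 'r) ring_scheme \<Rightarrow> ('a, 'v, 'm) module_scheme \<Rightarrow> 'v set \<Rightarrow> nat" where
  "subspace_dim K V W = vectorspace.dim K (V\<lparr>carrier := W\<rparr>)"

text \<open>A flag is the list of its members in increasing order; the empty list is the empty flag,
  and \<^term>\<open>carrier V\<close> itself may be the last member.\<close>

definition flags ::
  "('a, 'r) ring_scheme \<Rightarrow> ('a, 'v, 'm) module_scheme \<Rightarrow> 'v set list set" where
  "flags K V =
    {Vs. (\<forall>W\<in>set Vs. VectorSpace.subspace K W V \<and>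
            0 < subspace_dim K V W \<and> subspace_dim K V W \<le> vectorspace.dim K V) \<and>
         sorted_wrt (\<lambda>U W. U \<subset> W \<and> subspace_dim K V U < subspace_dim K V W) Vs}"

definition weighted_flags ::
  "('a, 'r) ring_scheme \<Rightarrow> ('a, 'v, 'm) module_scheme \<Rightarrow> ('v set list \<times> nat list) set" where
  "weighted_flags K V =
    {(Vs, ws). Vs \<in> flags K V \<and> length ws = length Vs \<and> (\<forall>w\<in>set ws. 0 < w)}"

definition flag_weight ::
  "('a, 'r) ring_scheme \<Rightarrow> ('a, 'v, 'm) module_scheme \<Rightarrow> 'v set list \<times> nat list \<Rightarrow> nat" where
  "flag_weight K V F = (\<Sum>i<length (fst F). snd F ! i * subspace_dim K V (fst F ! i))"

definition perm_inv :: "nat \<Rightarrow> (nat \<Rightarrow> nat) \<Rightarrow> nat" where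
  "perm_inv d \<sigma> = card {(i, j). 1 \<le> i \<and> i < j \<and> j \<le> d \<and> \<sigma> i > \<sigma> j}"

definition perm_maj :: "nat \<Rightarrow> (nat \<Rightarrow> nat) \<Rightarrow> nat" where
  "perm_maj d \<sigma> = (\<Sum>i | 1 \<le> i \<and> i < d \<and> \<sigma> i > \<sigma> (i + 1). i)"

definition inv_maj_fps :: "nat \<Rightarrow> nat \<Rightarrow> rat fps" where
  "inv_maj_fps q d =
    (\<Sum>\<sigma> | \<sigma> permutes {1..d}. of_nat q ^ perm_inv d \<sigma> * fps_X ^ perm_maj d \<sigma>)"

end

theory Submission
  imports Defs "HOL-Library.Cardinality"
begin

text \<open>
  A weighted flag amounts to a function \<open>w\<close> from \<open>{1..d}\<close> to the naturals together with a flag whose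
  set of dimensions is the support of \<open>w\<close>. The number of flags of \<open>F\<^sub>q\<^sup>d\<close> with set of dimensions
  \<open>S\<close>, where one may assume \<open>d \<in> S\<close>, is the sum of \<open>q\<close> to the power \<open>inv \<sigma>\<close> over all \<open>\<sigma>\<close> whose
  descents lie in \<open>S\<close>: both sides satisfy the same recursion on \<open>d\<close>. For flags, intersect with a fixed
  hyperplane and let \<open>p \<in> S\<close> be the least dimension of a member not contained in it; for permutations,
  delete the largest value and let \<open>p\<close> be its position. Both times \<open>p\<close> contributes a factor \<open>q\<close> to the
  power \<open>d - p\<close>, and the elements of \<open>S\<close> from \<open>p\<close> on drop by one. Interchanging the sums over \<open>w\<close> and
  \<open>\<sigma>\<close> and subtracting 1 from \<open>w\<close> at each descent of \<open>\<sigma>\<close> splits off the factor \<open>t\<close> to the power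
  \<open>maj \<sigma>\<close> and leaves the generating function of all \<open>w\<close>, which is the product of the \<open>1 / (1 - t\<^sup>j)\<close>.
\<close>

subsection \<open>Permutations with prescribed descents\<close>

definition descents :: "nat \<Rightarrow> (nat \<Rightarrow> nat) \<Rightarrow> nat set" where
  "descents d \<sigma> = {i. 1 \<le> i \<and> i < d \<and> \<sigma> i > \<sigma> (i + 1)}"

text \<open>In one-line notation, insert the value \<open>Suc d\<close> at position \<open>p\<close> of \<open>\<tau>\<close>.\<close>

definition insert_max :: "nat \<Rightarrow> nat \<Rightarrow> (nat \<Rightarrow> nat) \<Rightarrow> nat \<Rightarrow> nat" where
  "insert_max d p \<tau> = (\<lambda>i. if i < p \<or> Suc d < i then \<tau> i else if i = p then Suc d else \<tau> (i - 1))"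

text \<open>Describes what happens to \<open>S\<close> when the largest value is deleted from
  position \<open>p\<close>, and likewise when a flag is intersected with a hyperplane that its
  member of dimension \<open>p\<close> is the first to leave. If \<open>p - 1\<close> and
  \<open>p\<close> both lie in \<open>S\<close>, they merge: the largest value at \<open>p\<close>
  rules out a descent at \<open>p - 1\<close>, and the member of dimension \<open>p - 1\<close> is
  the intersection of the one of dimension \<open>p\<close> with the hyperplane.\<close>

definition shift :: "nat \<Rightarrow> nat set \<Rightarrow> nat set" where
  "shift p S = {s. s < p \<and> s \<in> S \<or> p \<le> Suc s \<and> Suc s \<in> S}"

text \<open>A q-multinomial coefficient whose lower entries are the gaps that the elements of
  \<open>S\<close> strictly between 0 and \<open>d\<close> cut into the interval from 0 to
  \<open>d\<close>. It enters only through its recursion \<open>perm_count_Suc\<close> and its value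
  at \<open>d = 0\<close>.\<close>

definition perm_count :: "nat \<Rightarrow> nat \<Rightarrow> nat set \<Rightarrow> nat" where
  "perm_count q d S = (\<Sum>\<sigma> | \<sigma> permutes {1..d} \<and> descents d \<sigma> \<subseteq> S. q ^ perm_inv d \<sigma>)"

lemma permutes_atLeast1D:
  assumes "\<tau> permutes {1..d::nat}"
  shows "1 \<le> i \<Longrightarrow> i \<le> d \<Longrightarrow> 1 \<le> \<tau> i \<and> \<tau> i \<le> d" "d < i \<Longrightarrow> \<tau> i = i" "\<tau> i = \<tau> j \<longleftrightarrow> i = j" "\<tau> 0 = 0"
  using permutes_in_image[OF assms, of i] permutes_not_in[OF assms, of i] permutes_not_in[OF assms, of 0]
    permutes_inj[OF assms] by (auto dest: injD)

lemma insert_max_permutes: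
  assumes \<tau>: "\<tau> permutes {1..d}" and p: "p \<in> {1..Suc d}"
  shows "insert_max d p \<tau> permutes {1..Suc d}"
proof -
  note T = permutes_atLeast1D[OF \<tau>]
  have inj: "inj_on (insert_max d p \<tau>) {1..Suc d}"
  proof (rule inj_onI)
    fix i j assume ij: "i \<in> {1..Suc d}" "j \<in> {1..Suc d}" "insert_max d p \<tau> i = insert_max d p \<tau> j"
    have a: "\<tau> i \<noteq> Suc d" if "i \<le> d" for i
      using T(1)[of i] T(4) that by (cases "i = 0") auto
    have "\<tau> (i - 1) \<noteq> Suc d" "\<tau> (j - 1) \<noteq> Suc d" "i < p \<Longrightarrow> \<tau> i \<noteq> Suc d" "j < p \<Longrightarrow> \<tau> j \<noteq> Suc d"
      using a ij p by auto
    then show "i = j"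
      using ij p by (cases i p rule: linorder_cases; cases j p rule: linorder_cases)
        (auto simp: insert_max_def T(3))
  qed
  have img: "insert_max d p \<tau> ` {1..Suc d} \<subseteq> {1..Suc d}"
  proof clarify
    fix i assume i: "i \<in> {1..Suc d}"
    show "insert_max d p \<tau> i \<in> {1..Suc d}"
    proof (cases i p rule: linorder_cases)
      case greater
      then have "1 \<le> i - 1" "i - 1 \<le> d" using i p by auto
      then show ?thesis using T(1)[of "i - 1"] greater i by (auto simp: insert_max_def)
    qed (use i p T(1)[of i] in \<open>auto simp: insert_max_def\<close>)
  qed
  have "bij_betw (insert_max d p \<tau>) {1..Suc d} {1..Suc d}"
    using inj endo_inj_surj[OF _ img inj] by (auto simp: bij_betw_def)
  then show ?thesis
  proof (rule bij_imp_permutes)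
    fix i assume "i \<notin> {1..Suc d}"
    then show "insert_max d p \<tau> i = i"
      using p T(2)[of i] T(4) by (cases "i = 0") (auto simp: insert_max_def)
  qed
qed

text \<open>Injectivity: \<open>p\<close> is recovered as the position of the value
  \<open>Suc d\<close>, and then \<open>\<tau>\<close> by reading off the other positions.
  Surjectivity follows by counting, since both sides have \<open>(d + 1)!\<close> elements.\<close>

lemma insert_max_bij:
  "bij_betw (\<lambda>(p, \<tau>). insert_max d p \<tau>) ({1..Suc d} \<times> {\<tau>. \<tau> permutes {1..d}}) {\<sigma>. \<sigma> permutes {1..Suc d}}"
proof -
  let ?A = "{1..Suc d} \<times> {\<tau>. \<tau> permutes {1..d}}" and ?h = "\<lambda>(p, \<tau>). insert_max d p \<tau>"
  have inj: "inj_on ?h ?A"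
  proof (rule inj_onI, clarify)
    fix p r \<tau> \<rho>
    assume p: "p \<in> {1..Suc d}" and r: "r \<in> {1..Suc d}" and \<tau>: "\<tau> permutes {1..d}" and \<rho>: "\<rho> permutes {1..d}"
      and eq: "insert_max d p \<tau> = insert_max d r \<rho>"
    note T = permutes_atLeast1D[OF \<tau>] and R = permutes_atLeast1D[OF \<rho>]
    have pos: "insert_max d p \<tau> p = Suc d" using p by (auto simp: insert_max_def)
    have pos': "insert_max d p \<tau> r = Suc d" unfolding eq using r by (auto simp: insert_max_def)
    have pr: "p = r"
      using pos pos' permutes_inj[OF insert_max_permutes[OF \<tau> p]] by (metis injD)
    have "\<tau> i = \<rho> i" for i
    proof (cases "i < p")
      case True
      then show ?thesis using fun_cong[OF eq, of i] pr by (auto simp: insert_max_def)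
    next
      case False
      then show ?thesis using fun_cong[OF eq, of "Suc i"] pr T(2)[of i] R(2)[of i]
        by (cases "i \<le> d") (auto simp: insert_max_def)
    qed
    then show "p = r \<and> \<tau> = \<rho>" using pr by auto
  qed
  have img: "?h ` ?A \<subseteq> {\<sigma>. \<sigma> permutes {1..Suc d}}"
    using insert_max_permutes by auto
  have "card ?A = card {\<sigma>. \<sigma> permutes {1..Suc d}}"
    by (simp add: card_cartesian_product card_permutations[OF refl])
  then have "?h ` ?A = {\<sigma>. \<sigma> permutes {1..Suc d}}"
    using img inj by (intro card_subset_eq) (auto simp: finite_permutations card_image)
  then show ?thesis using inj by (simp add: bij_betw_def)
qed

text \<open>The inserted maximum is a descent at \<open>p\<close> unless it comes last, and
  \<open>Suc d \<in> S\<close> covers that exception. It turns \<open>p - 1\<close> into an ascent;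
  a descent of \<open>\<tau>\<close> there is lost, but it imposes no condition on the right either,
  because \<open>p \<in> S\<close> puts \<open>p - 1\<close> into \<open>shift p S\<close>. Descents
  before \<open>p - 1\<close> stay and those from \<open>p\<close> on move up by one.\<close>

lemma descents_insert_max_subset_iff:
  assumes \<tau>: "\<tau> permutes {1..d}" and p: "p \<in> {1..Suc d}" and S: "Suc d \<in> S"
  shows "descents (Suc d) (insert_max d p \<tau>) \<subseteq> S \<longleftrightarrow> p \<in> S \<and> descents d \<tau> \<subseteq> shift p S"
proof -
  note T = permutes_atLeast1D[OF \<tau>]
  have a: "\<tau> i < Suc d" if "i \<le> d" for i
    using T(1)[of i] T(4) that by (cases "i = 0") auto
  have pd: "p \<in> descents (Suc d) (insert_max d p \<tau>) \<longleftrightarrow> p \<noteq> Suc d"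
    using p a[of p] by (auto simp: descents_def insert_max_def)
  have low: "i \<in> descents (Suc d) (insert_max d p \<tau>) \<longleftrightarrow> i \<in> descents d \<tau>" if "Suc i < p" for i
    using that p by (auto simp: descents_def insert_max_def)
  have mid: "i \<notin> descents (Suc d) (insert_max d p \<tau>)" if "Suc i = p" for i
    using that p a[of i] by (auto simp: descents_def insert_max_def)
  have high: "Suc i \<in> descents (Suc d) (insert_max d p \<tau>) \<longleftrightarrow> i \<in> descents d \<tau>" if "p \<le> i" for i
    using that p by (auto simp: descents_def insert_max_def)
  show ?thesis
  proof
    assume L: "descents (Suc d) (insert_max d p \<tau>) \<subseteq> S"
    have pS: "p \<in> S" using L pd S by blast
    have "i \<in> shift p S" if "i \<in> descents d \<tau>" for i
    proof -
      consider "Suc i < p" | "Suc i = p" | "p \<le> i" by linarith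
      then show ?thesis
        using that low[of i] high[of i] L pS by cases (auto simp: shift_def)
    qed
    then show "p \<in> S \<and> descents d \<tau> \<subseteq> shift p S" using pS by blast
  next
    assume R: "p \<in> S \<and> descents d \<tau> \<subseteq> shift p S"
    show "descents (Suc d) (insert_max d p \<tau>) \<subseteq> S"
    proof
      fix i assume i: "i \<in> descents (Suc d) (insert_max d p \<tau>)"
      consider "Suc i < p" | "Suc i = p" | "i = p" | "p < i" by linarith
      then show "i \<in> S"
        using i low[of i] mid[of i] R
      proof cases
        case 4
        then obtain j where "i = Suc j" "p \<le> j" by (cases i) auto
        then show ?thesis using i high[of j] R by (auto simp: shift_def)
      qed (auto simp: shift_def)
    qed
  qed
qed

text \<open>The new inversions are exactly the pairs formed by the maximum at \<open>p\<close> and a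
  later position; all others are transported from \<open>\<tau>\<close>.\<close>

lemma perm_inv_insert_max:
  assumes \<tau>: "\<tau> permutes {1..d}" and p: "p \<in> {1..Suc d}"
  shows "perm_inv (Suc d) (insert_max d p \<tau>) = perm_inv d \<tau> + (Suc d - p)"
proof -
  note T = permutes_atLeast1D[OF \<tau>]
  \<comment> \<open>The order embedding that skips position \<open>p\<close>, so that the new
    permutation composed with \<open>\<phi>\<close> is \<open>\<tau>\<close> on positions up to
    \<open>d\<close>.\<close>
  define \<phi> where "\<phi> i = (if i < p then i else Suc i)" for i
  let ?\<sigma> = "insert_max d p \<tau>"
  let ?I = "{(i, j). 1 \<le> i \<and> i < j \<and> j \<le> d \<and> \<tau> i > \<tau> j}"
  let ?J = "{(i, j). 1 \<le> i \<and> i < j \<and> j \<le> Suc d \<and> ?\<sigma> i > ?\<sigma> j}"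
  have a: "\<tau> i < Suc d" if "i \<le> d" for i
    using T(1)[of i] T(4) that by (cases "i = 0") auto
  have \<sigma>\<phi>: "?\<sigma> (\<phi> i) = \<tau> i" if "i \<le> d" for i
    using that p by (auto simp: \<phi>_def insert_max_def)
  have inj: "inj \<phi>" by (auto simp: \<phi>_def inj_def)
  have \<phi>_less: "\<phi> i < \<phi> j \<longleftrightarrow> i < j" for i j by (auto simp: \<phi>_def)
  have \<phi>_bd: "1 \<le> i \<Longrightarrow> 1 \<le> \<phi> i" "i \<le> d \<Longrightarrow> \<phi> i \<le> Suc d" for i by (auto simp: \<phi>_def)
  have ex: "\<exists>j. i = \<phi> j \<and> 1 \<le> j \<and> j \<le> d" if "1 \<le> i" "i \<le> Suc d" "i \<noteq> p" for i
  proof (cases "i < p")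
    case True then show ?thesis using that p by (intro exI[of _ i]) (auto simp: \<phi>_def)
  next
    case False then show ?thesis using that p by (intro exI[of _ "i - 1"]) (auto simp: \<phi>_def)
  qed
  have "?J = map_prod \<phi> \<phi> ` ?I \<union> {p} \<times> {p<..Suc d}"
  proof (intro equalityI subsetI)
    fix x assume "x \<in> ?J"
    then obtain i j where x: "x = (i, j)" "1 \<le> i" "i < j" "j \<le> Suc d" "?\<sigma> j < ?\<sigma> i" by auto
    show "x \<in> map_prod \<phi> \<phi> ` ?I \<union> {p} \<times> {p<..Suc d}"
    proof (cases "i = p")
      case True then show ?thesis using x by auto
    next
      case False
      then obtain i' where i': "i = \<phi> i'" "1 \<le> i'" "i' \<le> d" using ex[of i] x by auto
      have "?\<sigma> p = Suc d" using p by (auto simp: insert_max_def)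
      then have "j \<noteq> p" using x(5) \<sigma>\<phi>[OF i'(3)] a[OF i'(3)] i'(1) by force
      then obtain j' where j': "j = \<phi> j'" "1 \<le> j'" "j' \<le> d" using ex[of j] x by auto
      have "i' < j'" using x(3) \<phi>_less i'(1) j'(1) by simp
      moreover have "\<tau> j' < \<tau> i'" using x(5) \<sigma>\<phi>[OF i'(3)] \<sigma>\<phi>[OF j'(3)] i'(1) j'(1) by simp
      ultimately have "(i', j') \<in> ?I" using i' j' by simp
      moreover have "x = map_prod \<phi> \<phi> (i', j')" using x(1) i'(1) j'(1) by simp
      ultimately show ?thesis by blast
    qed
  next
    fix x assume "x \<in> map_prod \<phi> \<phi> ` ?I \<union> {p} \<times> {p<..Suc d}"
    then show "x \<in> ?J"
    proof
      assume "x \<in> map_prod \<phi> \<phi> ` ?I"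
      then obtain i j where "x = (\<phi> i, \<phi> j)" "1 \<le> i" "i < j" "j \<le> d" "\<tau> j < \<tau> i" by auto
      then show ?thesis using \<phi>_less[of i j] \<phi>_bd(1)[of i] \<phi>_bd(2)[of j] \<sigma>\<phi>[of i] \<sigma>\<phi>[of j] by simp
    next
      assume "x \<in> {p} \<times> {p<..Suc d}"
      then obtain j where j: "x = (p, j)" "p < j" "j \<le> Suc d" by auto
      then show ?thesis using p a[of "j - 1"] by (auto simp: insert_max_def)
    qed
  qed
  moreover have "finite ?I" by (rule finite_subset[of _ "{..d} \<times> {..d}"]) auto
  moreover have "map_prod \<phi> \<phi> ` ?I \<inter> {p} \<times> {p<..Suc d} = {}"
  proof -
    have "\<phi> i \<noteq> p" for i by (simp add: \<phi>_def)
    then show ?thesis by force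
  qed
  ultimately have "card ?J = card (map_prod \<phi> \<phi> ` ?I) + card ({p} \<times> {p<..Suc d})"
    by (simp add: card_Un_disjoint)
  also have "card (map_prod \<phi> \<phi> ` ?I) = card ?I"
    by (intro card_image inj_on_subset[OF prod.inj_map[OF inj inj]]) auto
  finally show ?thesis by (simp add: perm_inv_def card_cartesian_product)
qed

text \<open>Sort the permutations by the position \<open>p\<close> of the largest value. Here 0 is
  removed because it is not a position, while \<open>S\<close> may contain it: shifting at
  \<open>p = 1\<close> produces 0.\<close>

lemma perm_count_Suc:
  assumes "S \<subseteq> {..Suc d}" "Suc d \<in> S"
  shows "perm_count q (Suc d) S = (\<Sum>p\<in>S - {0}. q ^ (Suc d - p) * perm_count q d (shift p S))"
proof -
  let ?P = "\<lambda>d. {\<sigma>. \<sigma> permutes {1..d::nat}}"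
  \<comment> \<open>The descent condition becomes a conditional summand, so that the sum runs over
    the full set that \<open>insert_max_bij\<close> reindexes.\<close>
  have "perm_count q (Suc d) S =
      (\<Sum>\<sigma>\<in>?P (Suc d). if descents (Suc d) \<sigma> \<subseteq> S then q ^ perm_inv (Suc d) \<sigma> else 0)"
    unfolding perm_count_def
    by (rule sum.mono_neutral_cong_left) (auto simp: finite_permutations)
  also have "\<dots> = (\<Sum>(p, \<tau>)\<in>{1..Suc d} \<times> ?P d.
      if p \<in> S \<and> descents d \<tau> \<subseteq> shift p S then q ^ (Suc d - p) * q ^ perm_inv d \<tau> else 0)"
    unfolding sum.reindex_bij_betw[OF insert_max_bij, symmetric]
  proof (rule sum.cong[OF refl], clarify)
    fix p \<tau> assume "p \<in> {1..Suc d}" "\<tau> permutes {1..d}"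
    from descents_insert_max_subset_iff[OF this(2,1) assms(2)] perm_inv_insert_max[OF this(2,1)]
    show "(if descents (Suc d) (insert_max d p \<tau>) \<subseteq> S
        then q ^ perm_inv (Suc d) (insert_max d p \<tau>) else 0) =
      (if p \<in> S \<and> descents d \<tau> \<subseteq> shift p S then q ^ (Suc d - p) * q ^ perm_inv d \<tau> else 0)"
      by (simp only: power_add mult.commute)
  qed
  also have "\<dots> = (\<Sum>p\<in>{1..Suc d}. \<Sum>\<tau>\<in>?P d.
      if p \<in> S \<and> descents d \<tau> \<subseteq> shift p S then q ^ (Suc d - p) * q ^ perm_inv d \<tau> else 0)"
    by (simp add: sum.cartesian_product)
  also have "\<dots> = (\<Sum>p\<in>S - {0}. \<Sum>\<tau>\<in>?P d.
      if p \<in> S \<and> descents d \<tau> \<subseteq> shift p S then q ^ (Suc d - p) * q ^ perm_inv d \<tau> else 0)"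
    using assms(1) by (intro sum.mono_neutral_right) (auto intro!: sum.neutral split: if_splits)
  also have "\<dots> = (\<Sum>p\<in>S - {0}. q ^ (Suc d - p) * perm_count q d (shift p S))"
  proof (rule sum.cong[OF refl])
    fix p assume "p \<in> S - {0}"
    then show "(\<Sum>\<tau>\<in>?P d. if p \<in> S \<and> descents d \<tau> \<subseteq> shift p S
        then q ^ (Suc d - p) * q ^ perm_inv d \<tau> else 0) = q ^ (Suc d - p) * perm_count q d (shift p S)"
      unfolding perm_count_def sum_distrib_left
      by (intro sum.mono_neutral_cong_right) (auto simp: finite_permutations)
  qed
  finally show ?thesis .
qed

lemma perm_count_0: "perm_count q 0 S = 1"
proof -
  have "{\<sigma>. \<sigma> permutes {1..0::nat} \<and> descents 0 \<sigma> \<subseteq> S} = {id}"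
    by (auto simp: descents_def)
  moreover have "perm_inv 0 id = 0" unfolding perm_inv_def card_eq_0_iff by auto
  ultimately show ?thesis by (simp add: perm_count_def)
qed

subsection \<open>Subspaces of nested coordinate spaces\<close>

text \<open>
  Inside the functions on the naturals, the coordinate spaces \<open>fun_space d\<close> are nested, so that
  \<open>fun_space d\<close> is literally a hyperplane of \<open>fun_space (Suc d)\<close>. Over a finite field the dimension of
  a subspace can be read off its cardinality.
\<close>

definition fun_space :: "nat \<Rightarrow> (nat \<Rightarrow> 'k::zero) set" where
  "fun_space d = {x. \<forall>i\<ge>d. x i = 0}"

text \<open>A single closure condition carries all subspace axioms: \<open>y = x\<close> and
  \<open>c = -1\<close> give the zero function, and with \<open>x\<close> zero it gives the scalar
  multiples.\<close>

definition fun_subspace :: "(nat \<Rightarrow> 'k::comm_ring_1) set \<Rightarrow> bool" where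
  "fun_subspace W \<longleftrightarrow> W \<noteq> {} \<and> (\<forall>x\<in>W. \<forall>y\<in>W. \<forall>c. (\<lambda>i. x i + c * y i) \<in> W)"

definition fun_sum :: "(nat \<Rightarrow> 'k::plus) set \<Rightarrow> (nat \<Rightarrow> 'k) set \<Rightarrow> (nat \<Rightarrow> 'k) set" where
  "fun_sum U W = {\<lambda>i. x i + y i |x y. x \<in> U \<and> y \<in> W}"

lemma fun_sumI: "x \<in> U \<Longrightarrow> y \<in> W \<Longrightarrow> z = (\<lambda>i. x i + y i) \<Longrightarrow> z \<in> fun_sum U W"
  by (auto simp: fun_sum_def)

lemma fun_subspaceD:
  assumes "fun_subspace W"
  shows "x \<in> W \<Longrightarrow> y \<in> W \<Longrightarrow> (\<lambda>i. x i + c * y i) \<in> W"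
    and "x \<in> W \<Longrightarrow> y \<in> W \<Longrightarrow> (\<lambda>i. x i + y i) \<in> W"
    and "x \<in> W \<Longrightarrow> y \<in> W \<Longrightarrow> (\<lambda>i. x i - c * y i) \<in> W"
    and "(\<lambda>i. 0) \<in> W"
    and "x \<in> W \<Longrightarrow> (\<lambda>i. c * x i) \<in> W"
proof -
  show *: "x \<in> W \<Longrightarrow> y \<in> W \<Longrightarrow> (\<lambda>i. x i + c * y i) \<in> W" for x y c
    using assms by (auto simp: fun_subspace_def)
  show "x \<in> W \<Longrightarrow> y \<in> W \<Longrightarrow> (\<lambda>i. x i + y i) \<in> W" using *[of x y 1] by simp
  show "x \<in> W \<Longrightarrow> y \<in> W \<Longrightarrow> (\<lambda>i. x i - c * y i) \<in> W" using *[of x y "-c"] by simp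
  obtain z where "z \<in> W" using assms by (auto simp: fun_subspace_def)
  from *[OF this this, of "-1"] show 0: "(\<lambda>i. 0) \<in> W" by simp
  show "x \<in> W \<Longrightarrow> (\<lambda>i. c * x i) \<in> W" using *[OF 0, of x c] by simp
qed

lemma fun_subspace_fun_space: "fun_subspace (fun_space d)"
  unfolding fun_subspace_def
proof
  have "(\<lambda>i. 0) \<in> fun_space d" by (simp add: fun_space_def)
  then show "fun_space d \<noteq> {}" by blast
qed (auto simp: fun_space_def)

lemma fun_subspace_Int:
  assumes "fun_subspace U" "fun_subspace W" shows "fun_subspace (U \<inter> W)"
  using assms fun_subspaceD(4)[OF assms(1)] fun_subspaceD(4)[OF assms(2)]
  by (auto simp: fun_subspace_def)

lemma fun_subspace_fun_sum:
  assumes U: "fun_subspace U" and W: "fun_subspace W" shows "fun_subspace (fun_sum U W)"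
  unfolding fun_subspace_def
proof (intro conjI ballI allI)
  show "fun_sum U W \<noteq> {}"
    using fun_subspaceD(4)[OF U] fun_subspaceD(4)[OF W] by (auto simp: fun_sum_def)
  fix a b c assume "a \<in> fun_sum U W" "b \<in> fun_sum U W"
  then obtain x y x' y' where "x \<in> U" "y \<in> W" "a = (\<lambda>i. x i + y i)" "x' \<in> U" "y' \<in> W" "b = (\<lambda>i. x' i + y' i)"
    by (auto simp: fun_sum_def)
  moreover from this have "(\<lambda>i. x i + c * x' i) \<in> U" "(\<lambda>i. y i + c * y' i) \<in> W"
    using fun_subspaceD(1)[OF U] fun_subspaceD(1)[OF W] by auto
  moreover from calculation have "(\<lambda>i. a i + c * b i) = (\<lambda>i. (x i + c * x' i) + (y i + c * y' i))"
    by (simp add: algebra_simps)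
  ultimately show "(\<lambda>i. a i + c * b i) \<in> fun_sum U W"
    by (blast intro: fun_sumI)
qed

lemma fun_sum_upper:
  assumes "fun_subspace U" "fun_subspace W"
  shows "U \<subseteq> fun_sum U W" "W \<subseteq> fun_sum U W"
  using fun_sumI[OF _ fun_subspaceD(4)[OF assms(2)]] fun_sumI[OF fun_subspaceD(4)[OF assms(1)]]
  by auto

lemma fun_sum_least:
  assumes "fun_subspace X" "U \<subseteq> X" "W \<subseteq> X"
  shows "fun_sum U W \<subseteq> X"
  using assms fun_subspaceD(2)[OF assms(1)] by (auto simp: fun_sum_def)

lemma fun_sum_mono: "U \<subseteq> U' \<Longrightarrow> fun_sum U W \<subseteq> fun_sum U' W"
  by (auto simp: fun_sum_def)

section \<open>Subspaces relative to the hyperplane \<open>fun_space d\<close> of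
  \<open>fun_space (Suc d)\<close>\<close>

lemma fun_space_mono: "d \<le> e \<Longrightarrow> fun_space d \<subseteq> fun_space e"
  by (auto simp: fun_space_def)

lemma fun_space_Suc_iff: "x \<in> fun_space d \<longleftrightarrow> x \<in> fun_space (Suc d) \<and> x d = 0"
  unfolding fun_space_def by (auto simp: Suc_le_eq) (metis le_neq_implies_less)

lemma obtain_monic:
  fixes W :: "(nat \<Rightarrow> 'k::field) set"
  assumes W: "fun_subspace W" "W \<subseteq> fun_space (Suc d)" "\<not> W \<subseteq> fun_space d"
  obtains v where "v \<in> W" "v d = 1"
proof -
  obtain x where x: "x \<in> W" "x d \<noteq> 0" using W(2,3) fun_space_Suc_iff by blast
  have "(\<lambda>i. (1 / x d) * x i) \<in> W" by (rule fun_subspaceD(5)[OF W(1) x(1)])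
  then show ?thesis using that x(2) by auto
qed

text \<open>\<open>W\<close> is the direct sum of its intersection with the hyperplane and the line
  through \<open>v\<close>: since \<open>h\<close> vanishes at \<open>d\<close> and
  \<open>v d = 1\<close>, the coordinate \<open>d\<close> of a vector reads off
  \<open>c\<close>.\<close>

lemma bij_betw_add_multiple:
  fixes W :: "(nat \<Rightarrow> 'k::field) set"
  assumes W: "fun_subspace W" "W \<subseteq> fun_space (Suc d)" and v: "v \<in> W" "v d = 1"
  shows "bij_betw (\<lambda>(h, c) i. h i + c * v i) ((W \<inter> fun_space d) \<times> UNIV) W"
proof (rule bij_betw_byWitness[where f' = "\<lambda>x. ((\<lambda>i. x i - x d * v i), x d)"])
  show "\<forall>a\<in>(W \<inter> fun_space d) \<times> UNIV. (\<lambda>x. ((\<lambda>i. x i - x d * v i), x d)) ((\<lambda>(h, c) i. h i + c * v i) a) = a"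
    using v(2) by (auto simp: fun_space_def)
  show "\<forall>x\<in>W. (\<lambda>(h, c) i. h i + c * v i) ((\<lambda>i. x i - x d * v i), x d) = x" by auto
  show "(\<lambda>(h, c) i. h i + c * v i) ` ((W \<inter> fun_space d) \<times> UNIV) \<subseteq> W"
    using fun_subspaceD(1)[OF W(1) _ v(1)] by auto
  show "(\<lambda>x. (\<lambda>i. x i - x d * v i, x d)) ` W \<subseteq> (W \<inter> fun_space d) \<times> UNIV"
  proof clarify
    fix x assume x: "x \<in> W"
    have "(\<lambda>i. x i - x d * v i) \<in> W" by (rule fun_subspaceD(3)[OF W(1) x v(1)])
    then show "((\<lambda>i. x i - x d * v i) \<in> W \<inter> fun_space d) \<and> x d \<in> UNIV"
      using W(2) v(2) fun_space_Suc_iff[of "\<lambda>i. x i - x d * v i" d] by auto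
  qed
qed

lemma card_Int_fun_space:
  fixes W :: "(nat \<Rightarrow> 'k::{field,finite}) set"
  assumes W: "fun_subspace W" "W \<subseteq> fun_space (Suc d)" "\<not> W \<subseteq> fun_space d"
  shows "card W = CARD('k) * card (W \<inter> fun_space d)"
proof -
  obtain v where "v \<in> W" "v d = 1" using obtain_monic[OF W] .
  from bij_betw_same_card[OF bij_betw_add_multiple[OF W(1,2) this]]
  show ?thesis by (simp add: card_cartesian_product mult.commute)
qed

lemma card_fun_space: "card (fun_space d :: (nat \<Rightarrow> 'k::{field,finite}) set) = CARD('k) ^ d"
proof (induction d)
  case 0
  have "fun_space 0 = {\<lambda>i. 0 :: 'k}" by (auto simp: fun_space_def)
  then show ?case by simp
next
  case (Suc d)
  let ?e = "\<lambda>i. if i = d then 1 else (0::'k)"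
  have "?e \<in> fun_space (Suc d)" "?e \<notin> fun_space d" by (auto simp: fun_space_def)
  then have n: "\<not> fun_space (Suc d) \<subseteq> (fun_space d :: (nat \<Rightarrow> 'k) set)" by blast
  have "fun_space (Suc d) \<inter> fun_space d = (fun_space d :: (nat \<Rightarrow> 'k) set)"
    using fun_space_mono[of d "Suc d"] by auto
  then show ?case
    using card_Int_fun_space[OF fun_subspace_fun_space subset_refl n] Suc.IH by simp
qed

text \<open>The cardinality formula is already available and \<open>card\<close> is 0 on infinite
  sets, so positivity suffices.\<close>

lemma finite_fun_space: "finite (fun_space d :: (nat \<Rightarrow> 'k::{field,finite}) set)"
proof (rule card_ge_0_finite)
  show "0 < card (fun_space d :: (nat \<Rightarrow> 'k) set)"
    unfolding card_fun_space by (intro zero_less_power zero_less_card_finite)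
qed

text \<open>The candidates for the first member of a flag that leaves the hyperplane, once its
  intersection \<open>U\<close> with the hyperplane is known.\<close>

definition lifts :: "nat \<Rightarrow> (nat \<Rightarrow> 'k::comm_ring_1) set \<Rightarrow> (nat \<Rightarrow> 'k) set set" where
  "lifts d U = {W. fun_subspace W \<and> W \<subseteq> fun_space (Suc d) \<and> \<not> W \<subseteq> fun_space d \<and> W \<inter> fun_space d = U}"

text \<open>\<open>W\<close> supplies a vector \<open>v\<close> with \<open>v d = 1\<close>, and
  \<open>X\<close> is spanned by such a vector and its own part in the hyperplane. Hence all flag
  members above \<open>W\<close> can be rebuilt from \<open>W\<close> and their intersections with
  the hyperplane.\<close>

lemma fun_sum_eq_of_not_subset:
  fixes W :: "(nat \<Rightarrow> 'k::field) set"
  assumes X: "fun_subspace X" "X \<subseteq> fun_space (Suc d)"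
    and W: "fun_subspace W" "W \<subseteq> X" "\<not> W \<subseteq> fun_space d"
  shows "fun_sum (X \<inter> fun_space d) W = X"
proof
  show "fun_sum (X \<inter> fun_space d) W \<subseteq> X" by (rule fun_sum_least) (use X W in auto)
  obtain v where v: "v \<in> W" "v d = 1" using obtain_monic[of W d] X W by auto
  show "X \<subseteq> fun_sum (X \<inter> fun_space d) W"
  proof
    fix x assume "x \<in> X"
    moreover have "v \<in> X" using v W(2) by blast
    ultimately have "x \<in> (\<lambda>(h, c) i. h i + c * v i) ` ((X \<inter> fun_space d) \<times> UNIV)"
      using bij_betw_imp_surj_on[OF bij_betw_add_multiple[OF X, of v]] v(2) by simp
    then obtain h c where h: "x = (\<lambda>i. h i + c * v i)" "h \<in> X \<inter> fun_space d" by auto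
    have "(\<lambda>i. c * v i) \<in> W" by (rule fun_subspaceD(5)[OF W(1) v(1)])
    then show "x \<in> fun_sum (X \<inter> fun_space d) W"
      using fun_sumI[OF h(2) _ h(1)] by blast
  qed
qed

text \<open>An instance of the modular law: as \<open>G\<close> lies in the hyperplane, the left
  side is \<open>G\<close> plus the part of \<open>W\<close> in the hyperplane, and that part is in
  \<open>G\<close>.\<close>

lemma fun_sum_Int_fun_space:
  fixes W :: "(nat \<Rightarrow> 'k::field) set"
  assumes G: "fun_subspace G" "G \<subseteq> fun_space d" and "W \<inter> fun_space d \<subseteq> G" "W \<subseteq> fun_space (Suc d)"
    and W: "fun_subspace W"
  shows "fun_sum G W \<inter> fun_space d = G"
proof
  show "G \<subseteq> fun_sum G W \<inter> fun_space d" using fun_sum_upper[OF G(1) W] G(2) by blast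
  show "fun_sum G W \<inter> fun_space d \<subseteq> G"
  proof
    fix z assume z: "z \<in> fun_sum G W \<inter> fun_space d"
    then obtain x y where xy: "x \<in> G" "y \<in> W" "z = (\<lambda>i. x i + y i)" by (auto simp: fun_sum_def)
    have "x d = 0" "z d = 0" using xy(1) G(2) z by (auto simp: fun_space_def)
    then have "y \<in> fun_space d" using xy assms(4) fun_space_Suc_iff[of y d] by auto
    then have "y \<in> G" using xy(2) assms(3) by auto
    then show "z \<in> G" using fun_subspaceD(2)[OF G(1)] xy by auto
  qed
qed

lemma fun_subspace_line: "fun_subspace (range (\<lambda>c i. c * v i))"
  unfolding fun_subspace_def
proof (intro conjI ballI allI)
  fix x y c assume "x \<in> range (\<lambda>c i. c * v i)" "y \<in> range (\<lambda>c i. c * v i)"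
  then obtain a b where "x = (\<lambda>i. a * v i)" "y = (\<lambda>i. b * v i)" by auto
  then have "(\<lambda>i. x i + c * y i) = (\<lambda>i. (a + c * b) * v i)" by (simp add: algebra_simps)
  then show "(\<lambda>i. x i + c * y i) \<in> range (\<lambda>c i. c * v i)" by (rule range_eqI)
qed auto

text \<open>Double counting of the vectors \<open>v\<close> of \<open>fun_space (Suc d)\<close> with
  \<open>v d = 1\<close>. Each lies in exactly one lift, namely \<open>U\<close> plus the line
  through \<open>v\<close>, and each lift contains one coset of \<open>U\<close> of them.\<close>

lemma card_lifts:
  fixes U :: "(nat \<Rightarrow> 'k::{field,finite}) set"
  assumes U: "fun_subspace U" "U \<subseteq> fun_space d"
  shows "card (lifts d U) * card U = CARD('k) ^ d"
proof -
  let ?M = "\<lambda>W. {v\<in>W. v d = (1::'k)}"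
  have fin: "finite (fun_space (Suc d) :: (nat \<Rightarrow> 'k) set)" by (rule finite_fun_space)
  have finl: "finite (lifts d U)"
    by (rule finite_subset[of _ "Pow (fun_space (Suc d))"]) (use fin in \<open>auto simp: lifts_def\<close>)
  \<comment> \<open>The vectors of \<open>W\<close> with coordinate 1 at \<open>d\<close> are a
    translate of the part of \<open>W\<close> in the hyperplane.\<close>
  have coset: "card (?M W) = card (W \<inter> fun_space d)"
    if W: "fun_subspace W" "W \<subseteq> fun_space (Suc d)" "\<not> W \<subseteq> fun_space d" for W :: "(nat \<Rightarrow> 'k) set"
  proof -
    obtain v where v: "v \<in> W" "v d = 1" using obtain_monic[OF W] .
    have "bij_betw (\<lambda>h i. h i + v i) (W \<inter> fun_space d) (?M W)"
    proof (rule bij_betw_byWitness[where f' = "\<lambda>x i. x i - v i"])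
      show "(\<lambda>h i. h i + v i) ` (W \<inter> fun_space d) \<subseteq> ?M W"
        using fun_subspaceD(2)[OF W(1) _ v(1)] v(2) by (auto simp: fun_space_def)
      show "(\<lambda>x i. x i - v i) ` ?M W \<subseteq> W \<inter> fun_space d"
      proof clarify
        fix x assume x: "x \<in> W" "x d = 1"
        have "(\<lambda>i. x i - v i) \<in> W" using fun_subspaceD(3)[OF W(1) x(1) v(1), of 1] by simp
        then show "(\<lambda>i. x i - v i) \<in> W \<inter> fun_space d"
          using W(2) v(2) x(2) fun_space_Suc_iff[of "\<lambda>i. x i - v i" d] by auto
      qed
    qed auto
    then show ?thesis by (simp add: bij_betw_same_card)
  qed
  \<comment> \<open>A lift containing \<open>v\<close> is determined by \<open>U\<close> and
    \<open>v\<close>, so different lifts share no such vector.\<close>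
  have disj: "W = W'" if W: "W \<in> lifts d U" "W' \<in> lifts d U" and v: "v \<in> W" "v \<in> W'" "v d = 1" for W W' v
  proof -
    have "W = (\<lambda>(h, c) i. h i + c * v i) ` (U \<times> UNIV)" if "W \<in> lifts d U" "v \<in> W" for W
    proof -
      have W: "fun_subspace W" "W \<subseteq> fun_space (Suc d)" "W \<inter> fun_space d = U"
        using that(1) by (auto simp: lifts_def)
      from bij_betw_imp_surj_on[OF bij_betw_add_multiple[OF W(1,2) that(2) v(3)]]
      show ?thesis unfolding W(3) by (rule sym)
    qed
    from this[OF W(1) v(1)] this[OF W(2) v(2)] show ?thesis by simp
  qed
  have "(\<Union>W\<in>lifts d U. ?M W) = ?M (fun_space (Suc d))"
  proof
    show "?M (fun_space (Suc d)) \<subseteq> (\<Union>W\<in>lifts d U. ?M W)"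
    proof
      fix v assume v: "v \<in> ?M (fun_space (Suc d))"
      let ?L = "range (\<lambda>c i. c * v i)" and ?W = "fun_sum U (range (\<lambda>c i. c * v i))"
      have L: "?L \<subseteq> fun_space (Suc d)" using v by (auto simp: fun_space_def)
      have vL: "v \<in> ?L" by (rule range_eqI[of _ _ 1]) simp
      have L0: "?L \<inter> fun_space d \<subseteq> U"
      proof
        fix z assume "z \<in> ?L \<inter> fun_space d"
        then obtain c where z: "z = (\<lambda>i. c * v i)" "z d = 0" by (auto simp: fun_space_def)
        then have "c = 0" using v by simp
        then show "z \<in> U" using z(1) fun_subspaceD(4)[OF U(1)] by simp
      qed
      have vW: "v \<in> ?W" by (rule subsetD[OF fun_sum_upper(2)[OF U(1) fun_subspace_line] vL])
      have "v \<notin> fun_space d" using v by (auto simp: fun_space_def)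
      have "?W \<inter> fun_space d = U"
        by (rule fun_sum_Int_fun_space[OF U L0 L fun_subspace_line])
      moreover have "?W \<subseteq> fun_space (Suc d)"
        by (rule fun_sum_least[OF fun_subspace_fun_space subset_trans[OF U(2) fun_space_mono] L]) simp
      moreover have "\<not> ?W \<subseteq> fun_space d" by (rule contrapos_nn[OF \<open>v \<notin> fun_space d\<close> subsetD[OF _ vW]])
      ultimately have "?W \<in> lifts d U"
        unfolding lifts_def mem_Collect_eq
        by (intro conjI fun_subspace_fun_sum[OF U(1) fun_subspace_line])
      moreover have "v \<in> ?M ?W" using vW v by simp
      ultimately show "v \<in> (\<Union>W\<in>lifts d U. ?M W)" by (rule UN_I)
    qed
  qed (auto simp: lifts_def)
  moreover have "card (\<Union>W\<in>lifts d U. ?M W) = (\<Sum>W\<in>lifts d U. card (?M W))"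
  proof (intro card_UN_disjoint ballI impI finl)
    fix W assume "W \<in> lifts d U"
    then have "?M W \<subseteq> fun_space (Suc d)" by (auto simp: lifts_def)
    then show "finite (?M W)" using fin finite_subset by blast
  qed (use disj in blast)
  ultimately have "card (?M (fun_space (Suc d))) = (\<Sum>W\<in>lifts d U. card (?M W))" by simp
  also have "\<dots> = (\<Sum>W\<in>lifts d U. card U)"
    by (rule sum.cong) (auto simp: lifts_def coset)
  finally have "card (?M (fun_space (Suc d))) = card (lifts d U) * card U" by simp
  \<comment> \<open>The coset count applied to the whole space, whose part in the hyperplane is all
    of \<open>fun_space d\<close>.\<close>
  moreover have "card (?M (fun_space (Suc d))) = CARD('k) ^ d"
  proof -
    have "(\<lambda>i. if i = d then 1 else (0::'k)) \<in> fun_space (Suc d)"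
      "(\<lambda>i. if i = d then 1 else (0::'k)) \<notin> fun_space d" by (auto simp: fun_space_def)
    then have "\<not> fun_space (Suc d) \<subseteq> (fun_space d :: (nat \<Rightarrow> 'k) set)" by blast
    from coset[OF fun_subspace_fun_space subset_refl this]
    have "card (?M (fun_space (Suc d))) = card (fun_space (Suc d) \<inter> fun_space d :: (nat \<Rightarrow> 'k) set)" .
    moreover have "fun_space (Suc d) \<inter> fun_space d = (fun_space d :: (nat \<Rightarrow> 'k) set)"
      using fun_space_mono[of d "Suc d"] by auto
    ultimately show ?thesis by (simp add: card_fun_space)
  qed
  ultimately show ?thesis by simp
qed

subsection \<open>Flags with prescribed dimensions\<close>

text \<open>Flags indexed by dimension, with cardinality standing for dimension;
  \<open>extensional\<close> makes equal flags equal functions. For \<open>S\<close> within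
  \<open>{..d}\<close>, the members at 0 and at \<open>d\<close> are forced to be the zero space and
  the whole space, so including these indices does not change the number of flags.\<close>

definition flag_funs :: "nat \<Rightarrow> nat set \<Rightarrow> (nat \<Rightarrow> (nat \<Rightarrow> 'k::{field,finite}) set) set" where
  "flag_funs d S = {f \<in> extensional S.
     (\<forall>s\<in>S. fun_subspace (f s) \<and> f s \<subseteq> fun_space d \<and> card (f s) = CARD('k) ^ s) \<and>
     (\<forall>s\<in>S. \<forall>t\<in>S. s \<le> t \<longrightarrow> f s \<subseteq> f t)}"

lemma flag_funsD:
  fixes f :: "nat \<Rightarrow> (nat \<Rightarrow> 'k::{field,finite}) set"
  assumes "f \<in> flag_funs d S"
  shows "s \<in> S \<Longrightarrow> fun_subspace (f s)" "s \<in> S \<Longrightarrow> f s \<subseteq> fun_space d"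
    "s \<in> S \<Longrightarrow> card (f s) = CARD('k) ^ s" "s \<in> S \<Longrightarrow> t \<in> S \<Longrightarrow> s \<le> t \<Longrightarrow> f s \<subseteq> f t"
    "f \<in> extensional S"
  using assms by (auto simp: flag_funs_def)

lemma flag_funsI:
  fixes f :: "nat \<Rightarrow> (nat \<Rightarrow> 'k::{field,finite}) set"
  assumes "f \<in> extensional S" "\<And>s. s \<in> S \<Longrightarrow> fun_subspace (f s)" "\<And>s. s \<in> S \<Longrightarrow> f s \<subseteq> fun_space d"
    "\<And>s. s \<in> S \<Longrightarrow> card (f s) = CARD('k) ^ s" "\<And>s t. s \<in> S \<Longrightarrow> t \<in> S \<Longrightarrow> s \<le> t \<Longrightarrow> f s \<subseteq> f t"
  shows "f \<in> flag_funs d S"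
  using assms by (simp add: flag_funs_def)

lemma finite_flag_funs:
  assumes "finite S"
  shows "finite (flag_funs d S :: (nat \<Rightarrow> (nat \<Rightarrow> 'k::{field,finite}) set) set)"
proof (rule finite_subset)
  show "(flag_funs d S :: (nat \<Rightarrow> (nat \<Rightarrow> 'k) set) set) \<subseteq> S \<rightarrow>\<^sub>E Pow (fun_space d)"
    using flag_funsD(2,5) by (intro subsetI PiE_I) (blast, simp add: extensional_arb[OF flag_funsD(5)])
  show "finite (S \<rightarrow>\<^sub>E Pow (fun_space d :: (nat \<Rightarrow> 'k) set))"
    by (intro finite_PiE assms) (simp add: finite_fun_space)
qed

section \<open>Sorting flags by the dimension at which they leave the hyperplane\<close>

lemma one_less_card_field: "1 < CARD('k::{field,finite})"
  using card_mono[of "UNIV :: 'k set" "{0, 1}"] by simp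

definition crossing_flags :: "nat \<Rightarrow> nat set \<Rightarrow> nat \<Rightarrow> (nat \<Rightarrow> (nat \<Rightarrow> 'k::{field,finite}) set) set" where
  "crossing_flags d S p = {f \<in> flag_funs (Suc d) S. \<forall>s\<in>S. f s \<subseteq> fun_space d \<longleftrightarrow> s < p}"

text \<open>A flag \<open>f\<close> is encoded by the flag \<open>g\<close> of its intersections
  with the hyperplane, whose dimensions drop by one from \<open>p\<close> on, and by its first
  member \<open>W = f p\<close> outside. The later members are recovered as \<open>g (s - 1)\<close>
  plus \<open>W\<close>. Since \<open>W\<close> ranges over the lifts of \<open>g (p - 1)\<close>,
  the number of choices for it is the same power of \<open>q\<close> for every
  \<open>g\<close>.\<close>

lemma card_crossing_flags:
  assumes S: "S \<subseteq> {..Suc d}" and p: "p \<in> S" "p \<noteq> 0"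
  shows "card (crossing_flags d S p :: (nat \<Rightarrow> (nat \<Rightarrow> 'k::{field,finite}) set) set) =
    CARD('k) ^ (Suc d - p) * card (flag_funs d (shift p S) :: (nat \<Rightarrow> (nat \<Rightarrow> 'k) set) set)"
proof -
  let ?q = "CARD('k)"
  let ?H = "fun_space d :: (nat \<Rightarrow> 'k) set" and ?V = "fun_space (Suc d) :: (nat \<Rightarrow> 'k) set"
  let ?G = "flag_funs d (shift p S) :: (nat \<Rightarrow> (nat \<Rightarrow> 'k) set) set"
  let ?F = "crossing_flags d S p :: (nat \<Rightarrow> (nat \<Rightarrow> 'k) set) set"
  let ?up = "\<lambda>(g, W). restrict (\<lambda>s. if s < p then g s else fun_sum (g (s - 1)) W) S"
  let ?dn = "\<lambda>f. (restrict (\<lambda>s. if p \<le> Suc s then f (Suc s) \<inter> ?H else f s) (shift p S), f p)"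
  have HV: "?H \<subseteq> ?V" by (rule fun_space_mono) simp
  have p1: "p - 1 \<in> shift p S" using p by (auto simp: shift_def)
  have below: "s \<in> shift p S" if "s \<in> S" "s < p" for s using that by (auto simp: shift_def)
  have above: "s - 1 \<in> shift p S" if "s \<in> S" "p \<le> s" for s using that p by (cases s) (auto simp: shift_def)
  \<comment> \<open>The index \<open>p - 1\<close> always counts as coming from \<open>p\<close>,
    even if \<open>p - 1\<close> is itself in \<open>S\<close>; this makes the two cases exclusive
    and matches the case distinction in \<open>?dn\<close>.\<close>
  have shiftE: "p \<le> Suc s \<and> Suc s \<in> S \<or> Suc s < p \<and> s \<in> S" if "s \<in> shift p S" for s
    using that p by (cases "p = Suc s") (auto simp: shift_def)

  \<comment> \<open>The rebuilt members have the right dimension and intersection because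
    \<open>W\<close> meets the hyperplane in \<open>g (p - 1)\<close>, which is contained in
    \<open>g (s - 1)\<close>.\<close>
  have sum_props: "fun_subspace (fun_sum (g (s - 1)) W) \<and> fun_sum (g (s - 1)) W \<subseteq> ?V \<and>
      \<not> fun_sum (g (s - 1)) W \<subseteq> ?H \<and> fun_sum (g (s - 1)) W \<inter> ?H = g (s - 1) \<and>
      card (fun_sum (g (s - 1)) W) = ?q ^ s"
    if g: "g \<in> ?G" and W: "W \<in> lifts d (g (p - 1))" and s: "s \<in> S" "p \<le> s" for g W s
  proof -
    note G = flag_funsD[OF g]
    have W': "fun_subspace W" "W \<subseteq> ?V" "\<not> W \<subseteq> ?H" "W \<inter> ?H = g (p - 1)"
      using W by (auto simp: lifts_def)
    have sh: "s - 1 \<in> shift p S" by (rule above[OF s])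
    have sub: "fun_subspace (fun_sum (g (s - 1)) W)"
      by (rule fun_subspace_fun_sum[OF G(1)[OF sh] W'(1)])
    have V: "fun_sum (g (s - 1)) W \<subseteq> ?V"
      by (rule fun_sum_least[OF fun_subspace_fun_space subset_trans[OF G(2)[OF sh] HV] W'(2)])
    have nH: "\<not> fun_sum (g (s - 1)) W \<subseteq> ?H"
      using subset_trans[OF fun_sum_upper(2)[OF G(1)[OF sh] W'(1)]] W'(3) by (rule contrapos_nn[rotated])
    have "W \<inter> ?H \<subseteq> g (s - 1)" unfolding W'(4) by (rule G(4)[OF p1 sh]) (use s in simp)
    then have I: "fun_sum (g (s - 1)) W \<inter> ?H = g (s - 1)"
      by (rule fun_sum_Int_fun_space[OF G(1,2)[OF sh] _ W'(2,1)])
    have "card (fun_sum (g (s - 1)) W) = ?q * ?q ^ (s - 1)"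
      using card_Int_fun_space[OF sub V nH] unfolding I G(3)[OF sh] .
    also have "\<dots> = ?q ^ s" using p s by (cases s) auto
    finally show ?thesis using sub V nH I by (intro conjI)
  qed

  have int_card: "card (f s \<inter> ?H) = ?q ^ (s - 1)" if f: "f \<in> ?F" and s: "s \<in> S" "p \<le> s" for f s
  proof -
    have f': "f \<in> flag_funs (Suc d) S" and nH: "\<not> f s \<subseteq> ?H" using f s by (auto simp: crossing_flags_def)
    have "?q * card (f s \<inter> ?H) = ?q ^ s"
      using card_Int_fun_space[OF flag_funsD(1,2)[OF f' s(1)] nH] flag_funsD(3)[OF f' s(1)] by simp
    also have "\<dots> = ?q * ?q ^ (s - 1)" using p s by (cases s) auto
    finally show ?thesis by simp
  qed

  have "bij_betw ?up (Sigma ?G (\<lambda>g. lifts d (g (p - 1)))) ?F"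
  proof (rule bij_betw_byWitness[where f' = ?dn])
    show "\<forall>x\<in>Sigma ?G (\<lambda>g. lifts d (g (p - 1))). ?dn (?up x) = x"
    proof
      fix x assume "x \<in> Sigma ?G (\<lambda>g. lifts d (g (p - 1)))"
      then obtain g W where x: "x = (g, W)" and g: "g \<in> ?G" and W: "W \<in> lifts d (g (p - 1))"
        by (rule SigmaE)
      have W': "fun_subspace W" "W \<subseteq> ?V" "\<not> W \<subseteq> ?H" "W \<inter> ?H = g (p - 1)"
        using W by (auto simp: lifts_def)
      \<comment> \<open>At \<open>s = p\<close> the rebuilt member is \<open>W\<close> itself, since
        \<open>g (p - 1)\<close> is its part in the hyperplane.\<close>
      have "fun_sum (g (p - 1)) W = W"
        using fun_sum_eq_of_not_subset[OF W'(1,2,1) subset_refl W'(3)] W'(4) by simp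
      then have 2: "?up (g, W) p = W" using p by simp
      have "(if p \<le> Suc s then ?up (g, W) (Suc s) \<inter> ?H else ?up (g, W) s) = g s" if s: "s \<in> shift p S" for s
      proof (cases "p \<le> Suc s")
        case True
        then have "Suc s \<in> S" using shiftE[OF s] by simp
        moreover have "fun_sum (g (Suc s - 1)) W \<inter> ?H = g (Suc s - 1)"
          using sum_props[OF g W \<open>Suc s \<in> S\<close> True] by (elim conjE)
        ultimately show ?thesis using True by simp
      next
        case False
        then show ?thesis using shiftE[OF s] by simp
      qed
      then have "restrict (\<lambda>s. if p \<le> Suc s then ?up (g, W) (Suc s) \<inter> ?H else ?up (g, W) s) (shift p S) = g"
        using flag_funsD(5)[OF g] by (intro extensionalityI[of _ "shift p S"]) auto
      with 2 show "?dn (?up x) = x" unfolding x by simp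
    qed
    show "\<forall>f\<in>?F. ?up (?dn f) = f"
    proof
      fix f assume f: "f \<in> ?F"
      then have f': "f \<in> flag_funs (Suc d) S" and cross: "\<And>s. s \<in> S \<Longrightarrow> f s \<subseteq> ?H \<longleftrightarrow> s < p"
        by (auto simp: crossing_flags_def)
      note F = flag_funsD[OF f']
      have "?up (?dn f) s = f s" if s: "s \<in> S" for s
      proof (cases "s < p")
        case True
        \<comment> \<open>The merged index: \<open>?dn\<close> stores the intersection of
          \<open>f p\<close> with the hyperplane at \<open>p - 1\<close>, which must agree with the
          member of dimension \<open>p - 1\<close> if there is one. One contains the other and both
          have the same cardinality.\<close>
        have "f s = f p \<inter> ?H" if "p = Suc s"
        proof (rule card_subset_eq)
          show "finite (f p \<inter> ?H)" using finite_fun_space by blast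
          show "f s \<subseteq> f p \<inter> ?H" using F(4)[OF s p(1)] cross[OF s] True by auto
          show "card (f s) = card (f p \<inter> ?H)" using int_card[OF f p(1)] F(3)[OF s] that by simp
        qed
        then show ?thesis using True s below[OF s True] by auto
      next
        case False
        then have "s - 1 \<in> shift p S" "Suc (s - 1) = s" using above[OF s] p by auto
        moreover have "fun_sum (f s \<inter> ?H) (f p) = f s"
          using fun_sum_eq_of_not_subset[OF F(1,2)[OF s] F(1)[OF p(1)] F(4)[OF p(1) s]] cross[OF p(1)] False
          by simp
        ultimately show ?thesis using False s by simp
      qed
      then show "?up (?dn f) = f"
        using F(5) by (intro extensionalityI[of _ S]) auto
    qed
    show "?up ` Sigma ?G (\<lambda>g. lifts d (g (p - 1))) \<subseteq> ?F"
    proof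
      fix f assume "f \<in> ?up ` Sigma ?G (\<lambda>g. lifts d (g (p - 1)))"
      then obtain x where x: "f = ?up x" "x \<in> Sigma ?G (\<lambda>g. lifts d (g (p - 1)))" by (rule imageE)
      from x(2) obtain g W where gW: "x = (g, W)" and g: "g \<in> ?G" and W: "W \<in> lifts d (g (p - 1))"
        by (rule SigmaE)
      have f: "f = ?up (g, W)" using x(1) unfolding gW .
      note G = flag_funsD[OF g] and P = sum_props[OF g W]
      let ?f = "?up (g, W)"
      have lo: "?f s = g s" if "s \<in> S" "s < p" for s using that by simp
      have hi: "?f s = fun_sum (g (s - 1)) W" if "s \<in> S" "p \<le> s" for s using that by simp
      have W': "fun_subspace W" using W by (auto simp: lifts_def)
      have "?f \<in> flag_funs (Suc d) S"
      proof (rule flag_funsI)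
        fix s assume s: "s \<in> S"
        show "fun_subspace (?f s)"
          by (cases "s < p") (use lo[OF s] hi[OF s] G(1) below[OF s] P[OF s] in simp_all)
        show "?f s \<subseteq> ?V"
          by (cases "s < p") (use lo[OF s] hi[OF s] G(2)[OF below[OF s]] HV P[OF s] in auto)
        show "card (?f s) = ?q ^ s"
          by (cases "s < p") (use lo[OF s] hi[OF s] G(3)[OF below[OF s]] P[OF s] in simp_all)
        fix t assume t: "t \<in> S" "s \<le> t"
        show "?f s \<subseteq> ?f t"
        proof (cases "t < p")
          case True
          then show ?thesis using lo[OF s] lo[OF t(1)] G(4)[OF below[OF s] below[OF t(1)]] t(2) by simp
        next
          case t': False
          show ?thesis
          proof (cases "s < p")
            case True
            have "g s \<subseteq> g (t - 1)"
              using G(4)[OF below[OF s True] above[OF t(1)]] t' True by simp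
            also have "\<dots> \<subseteq> fun_sum (g (t - 1)) W"
              by (rule fun_sum_upper(1)[OF G(1)[OF above[OF t(1)]] W']) (use t' in simp)
            finally show ?thesis using lo[OF s True] hi[OF t(1)] t' by simp
          next
            case False
            have "g (s - 1) \<subseteq> g (t - 1)"
              using G(4)[OF above[OF s] above[OF t(1)]] t' False t(2) by simp
            then show ?thesis using hi[OF s] hi[OF t(1)] t' False fun_sum_mono by simp
          qed
        qed
      qed simp
      moreover have "?f s \<subseteq> ?H \<longleftrightarrow> s < p" if s: "s \<in> S" for s
        by (cases "s < p") (use lo[OF s] hi[OF s] G(2)[OF below[OF s]] P[OF s] in simp_all)
      ultimately show "f \<in> ?F" unfolding f crossing_flags_def mem_Collect_eq by (intro conjI ballI)
    qed
    show "?dn ` ?F \<subseteq> Sigma ?G (\<lambda>g. lifts d (g (p - 1)))"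
    proof
      fix x assume "x \<in> ?dn ` ?F"
      then obtain f where x: "x = ?dn f" and f: "f \<in> ?F" by (rule imageE)
      have f': "f \<in> flag_funs (Suc d) S" and cross: "\<And>s. s \<in> S \<Longrightarrow> f s \<subseteq> ?H \<longleftrightarrow> s < p"
        using f by (auto simp: crossing_flags_def)
      note F = flag_funsD[OF f']
      define g where "g = restrict (\<lambda>s. if p \<le> Suc s then f (Suc s) \<inter> ?H else f s) (shift p S)"
      have hi: "g s = f (Suc s) \<inter> ?H" if "s \<in> shift p S" "p \<le> Suc s" for s
        using that by (simp add: g_def)
      have lo: "g s = f s" if "s \<in> shift p S" "\<not> p \<le> Suc s" for s
        using that by (simp add: g_def)
      have inS: "p \<le> Suc s \<Longrightarrow> Suc s \<in> S" "\<not> p \<le> Suc s \<Longrightarrow> s \<in> S \<and> s < p" if "s \<in> shift p S" for s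
        using shiftE[OF that] by auto
      have "g \<in> ?G"
      proof (rule flag_funsI)
        show "g \<in> extensional (shift p S)" by (simp add: g_def)
        fix s assume s: "s \<in> shift p S"
        show "fun_subspace (g s)"
          using hi[OF s] lo[OF s] inS[OF s] F(1) fun_subspace_Int[OF _ fun_subspace_fun_space]
          by (cases "p \<le> Suc s") auto
        show "g s \<subseteq> ?H"
          using hi[OF s] lo[OF s] inS[OF s] cross[of s] by (cases "p \<le> Suc s") auto
        show "card (g s) = ?q ^ s"
          using hi[OF s] lo[OF s] inS[OF s] int_card[OF f, of "Suc s"] F(3)[of s]
          by (cases "p \<le> Suc s") auto
        fix t assume t: "t \<in> shift p S" "s \<le> t"
        consider "p \<le> Suc s" "p \<le> Suc t" | "\<not> p \<le> Suc s" "p \<le> Suc t" | "\<not> p \<le> Suc s" "\<not> p \<le> Suc t"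
          using t(2) by linarith
        then show "g s \<subseteq> g t"
        proof cases
          case 1
          then have "f (Suc s) \<subseteq> f (Suc t)" using inS[OF s] inS[OF t(1)] t(2) F(4) by simp
          then show ?thesis using hi[OF s 1(1)] hi[OF t(1) 1(2)] by auto
        next
          case 2
          then have "f s \<subseteq> f (Suc t)" using inS[OF s] inS[OF t(1)] t(2) F(4) by simp
          moreover have "f s \<subseteq> ?H" using inS[OF s] cross[of s] 2 by simp
          ultimately show ?thesis using lo[OF s 2(1)] hi[OF t(1) 2(2)] by auto
        next
          case 3
          then show ?thesis using inS[OF s] inS[OF t(1)] t(2) F(4) lo[OF s] lo[OF t(1)] by simp
        qed
      qed
      moreover have "f p \<in> lifts d (g (p - 1))"
        using F(1,2)[OF p(1)] cross[OF p(1)] hi[OF p1] p(2) by (simp add: lifts_def)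
      moreover have "x = (g, f p)" unfolding x g_def ..
      ultimately show "x \<in> Sigma ?G (\<lambda>g. lifts d (g (p - 1)))" by simp
    qed
  qed
  then have "card ?F = card (Sigma ?G (\<lambda>g. lifts d (g (p - 1))))" by (simp add: bij_betw_same_card)
  also have "\<dots> = (\<Sum>g\<in>?G. card (lifts d (g (p - 1))))"
  proof (rule card_SigmaI)
    have "shift p S \<subseteq> {..Suc d}" using S by (auto simp: shift_def)
    then have "finite (shift p S)" using finite_subset by blast
    then show "finite ?G" by (rule finite_flag_funs)
    show "\<forall>g\<in>?G. finite (lifts d (g (p - 1)))"
      by (auto simp: lifts_def intro!: finite_subset[of _ "Pow ?V"] finite_fun_space)
  qed
  also have "\<dots> = (\<Sum>g\<in>?G. ?q ^ (Suc d - p))"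
  proof (rule sum.cong[OF refl])
    fix g assume "g \<in> ?G"
    note G = flag_funsD(1-3)[OF this p1]
    have "card (lifts d (g (p - 1))) * ?q ^ (p - 1) = ?q ^ d" using card_lifts[OF G(1,2)] G(3) by simp
    \<comment> \<open>The exponent is \<open>d\<close>, since \<open>p\<close> lies between 1 and
      \<open>Suc d\<close>; the factor for \<open>g (p - 1)\<close> can then be cancelled.\<close>
    also have "\<dots> = ?q ^ (Suc d - p + (p - 1))" using S p by (intro arg_cong[of _ _ "(^) ?q"]) auto
    finally show "card (lifts d (g (p - 1))) = ?q ^ (Suc d - p)" by (simp add: power_add)
  qed
  finally show ?thesis by simp
qed

text \<open>The flags split into disjoint classes by the least dimension \<open>p\<close> of a
  member outside the hyperplane. Such a member exists because \<open>Suc d \<in> S\<close> forces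
  the whole space to be a member, and \<open>p\<close> is not 0 because the zero space lies in the
  hyperplane.\<close>

lemma card_flag_funs_Suc:
  assumes S: "S \<subseteq> {..Suc d}" "Suc d \<in> S"
  shows "card (flag_funs (Suc d) S :: (nat \<Rightarrow> (nat \<Rightarrow> 'k::{field,finite}) set) set) =
    (\<Sum>p\<in>S - {0}. CARD('k) ^ (Suc d - p) *
      card (flag_funs d (shift p S) :: (nat \<Rightarrow> (nat \<Rightarrow> 'k) set) set))"
proof -
  let ?H = "fun_space d :: (nat \<Rightarrow> 'k) set"
  let ?A = "flag_funs (Suc d) S :: (nat \<Rightarrow> (nat \<Rightarrow> 'k) set) set"
  let ?F = "crossing_flags d S :: nat \<Rightarrow> (nat \<Rightarrow> (nat \<Rightarrow> 'k) set) set"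
  have fin: "finite S" using S finite_subset by blast
  have "?A = (\<Union>p\<in>S - {0}. ?F p)"
  proof
    show "?A \<subseteq> (\<Union>p\<in>S - {0}. ?F p)"
    proof
      fix f assume f: "f \<in> ?A"
      note F = flag_funsD[OF f]
      let ?B = "{s \<in> S. \<not> f s \<subseteq> ?H}"
      have "\<not> f (Suc d) \<subseteq> ?H"
      proof
        assume "f (Suc d) \<subseteq> ?H"
        from card_mono[OF finite_fun_space this] have "CARD('k) ^ Suc d \<le> CARD('k) ^ d"
          unfolding F(3)[OF S(2)] card_fun_space .
        then show False using one_less_card_field[where 'k = 'k] by simp
      qed
      then have B: "finite ?B" "?B \<noteq> {}" using fin S(2) by auto
      define p where "p = Min ?B"
      have p: "p \<in> S" "\<not> f p \<subseteq> ?H" using Min_in[OF B] by (auto simp: p_def)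
      have "p \<noteq> 0"
      proof
        assume "p = 0"
        then have "card (f p) = 1" using F(3)[OF p(1)] by simp
        then have "f p = {\<lambda>i. 0}" using fun_subspaceD(4)[OF F(1)[OF p(1)]] by (auto simp: card_1_singleton_iff)
        then show False using p(2) by (simp add: fun_space_def)
      qed
      moreover have "f s \<subseteq> ?H \<longleftrightarrow> s < p" if s: "s \<in> S" for s
      proof
        assume "f s \<subseteq> ?H"
        then show "s < p" using F(4)[OF p(1) s] p(2) by (meson leI subset_trans)
      next
        assume "s < p"
        then show "f s \<subseteq> ?H" using Min_le[OF B(1), of s] s by (auto simp: p_def)
      qed
      ultimately show "f \<in> (\<Union>p\<in>S - {0}. ?F p)" using p(1) f by (auto simp: crossing_flags_def)
    qed
  qed (auto simp: crossing_flags_def)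
  moreover have "card (\<Union>p\<in>S - {0}. ?F p) = (\<Sum>p\<in>S - {0}. card (?F p))"
  proof (intro card_UN_disjoint ballI impI)
    show "finite (?F p)" for p
      by (rule finite_subset[OF _ finite_flag_funs[OF fin]]) (auto simp: crossing_flags_def)
    fix p r assume pr: "p \<in> S - {0}" "r \<in> S - {0}" "p \<noteq> r"
    \<comment> \<open>Both \<open>p\<close> and \<open>r\<close> are in \<open>S\<close>, so testing
      the crossing condition at these two indices gives \<open>p = r\<close>.\<close>
    have False if "f \<in> ?F p" "f \<in> ?F r" for f
    proof -
      have "s < p \<longleftrightarrow> s < r" if "s \<in> S" for s
        using that \<open>f \<in> ?F p\<close> \<open>f \<in> ?F r\<close> by (simp add: crossing_flags_def)
      from this[of p] this[of r] pr show False by simp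
    qed
    then show "?F p \<inter> ?F r = {}" by blast
  qed (use fin in simp)
  ultimately have "card ?A = (\<Sum>p\<in>S - {0}. card (?F p))" by simp
  then show ?thesis using card_crossing_flags[OF S(1), where 'k = 'k] by simp
qed

subsection \<open>Generating functions\<close>

text \<open>Here \<open>w s\<close> is the weight of the member of dimension \<open>s\<close>, and 0
  means that there is no such member. Equivalently, these are the multiplicity functions of the
  partitions of \<open>n\<close> into parts of size at most \<open>d\<close>.\<close>

definition weight_funs :: "nat \<Rightarrow> nat \<Rightarrow> (nat \<Rightarrow> nat) set" where
  "weight_funs d n = {w. (\<forall>s. w s \<noteq> 0 \<longrightarrow> s \<in> {1..d}) \<and> (\<Sum>s=1..d. w s * s) = n}"

lemma finite_weight_funs: "finite (weight_funs d n)"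
proof (rule finite_subset)
  show "weight_funs d n \<subseteq> {w. \<forall>s. (s \<in> {1..d} \<longrightarrow> w s \<in> {..n}) \<and> (s \<notin> {1..d} \<longrightarrow> w s = 0)}"
  proof
    fix w assume w: "w \<in> weight_funs d n"
    have "w s \<le> n" if s: "s \<in> {1..d}" for s
    proof -
      have "w s * 1 \<le> w s * s" using s by (intro mult_le_mono) auto
      also have "\<dots> \<le> (\<Sum>s=1..d. w s * s)" using s by (intro member_le_sum) auto
      finally show ?thesis using w by (simp add: weight_funs_def)
    qed
    then show "w \<in> {w. \<forall>s. (s \<in> {1..d} \<longrightarrow> w s \<in> {..n}) \<and> (s \<notin> {1..d} \<longrightarrow> w s = 0)}"
      using w by (auto simp: weight_funs_def)
  qed
qed (intro finite_set_of_finite_funs; simp)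

text \<open>Subtracting 1 from \<open>w\<close> at every point of \<open>D\<close> lowers the
  weighted sum by the sum of \<open>D\<close> and leaves an arbitrary weight function. With
  \<open>D\<close> the descent set this is what produces the exponent \<open>maj\<close>.\<close>

lemma card_weight_funs_superset:
  assumes "D \<subseteq> {1..d}"
  shows "card {w \<in> weight_funs d n. \<forall>s\<in>D. w s \<noteq> 0} = (if \<Sum>D \<le> n then card (weight_funs d (n - \<Sum>D)) else 0)"
proof -
  let ?up = "\<lambda>w s. w s + (if s \<in> D then 1 else 0 :: nat)" and ?dn = "\<lambda>w s. w s - (if s \<in> D then 1 else 0 :: nat)"
  have up: "(\<Sum>s=1..d. ?up w s * s) = (\<Sum>s=1..d. w s * s) + \<Sum>D" for w
  proof -
    have "(\<Sum>s=1..d. ?up w s * s) = (\<Sum>s=1..d. w s * s) + (\<Sum>s=1..d. if s \<in> D then s else 0)"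
      unfolding sum.distrib[symmetric] by (rule sum.cong) auto
    also have "(\<Sum>s=1..d. if s \<in> D then s else 0) = \<Sum>D"
      using assms by (intro sum.mono_neutral_cong_right) auto
    finally show ?thesis .
  qed
  have updn: "?up (?dn w) = w" if "\<forall>s\<in>D. w s \<noteq> 0" for w
  proof
    fix s show "?up (?dn w) s = w s" using that by (cases "s \<in> D") auto
  qed
  show ?thesis
  proof (cases "\<Sum>D \<le> n")
    case True
    have "bij_betw ?up (weight_funs d (n - \<Sum>D)) {w \<in> weight_funs d n. \<forall>s\<in>D. w s \<noteq> 0}"
    proof (rule bij_betw_byWitness[where f' = ?dn])
      show "?up ` weight_funs d (n - \<Sum>D) \<subseteq> {w \<in> weight_funs d n. \<forall>s\<in>D. w s \<noteq> 0}"
      proof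
        fix u assume "u \<in> ?up ` weight_funs d (n - \<Sum>D)"
        then obtain w where u: "u = ?up w" and w: "w \<in> weight_funs d (n - \<Sum>D)" by (rule imageE)
        have "(\<Sum>s=1..d. u s * s) = n" using w True unfolding u up by (simp add: weight_funs_def)
        moreover have "s \<in> {1..d}" if "u s \<noteq> 0" for s
          using that w assms unfolding u weight_funs_def by (cases "s \<in> D") auto
        moreover have "\<forall>s\<in>D. u s \<noteq> 0" by (simp add: u)
        ultimately show "u \<in> {w \<in> weight_funs d n. \<forall>s\<in>D. w s \<noteq> 0}" by (auto simp: weight_funs_def)
      qed
      show "?dn ` {w \<in> weight_funs d n. \<forall>s\<in>D. w s \<noteq> 0} \<subseteq> weight_funs d (n - \<Sum>D)"
      proof
        fix u assume "u \<in> ?dn ` {w \<in> weight_funs d n. \<forall>s\<in>D. w s \<noteq> 0}"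
        then obtain w where u: "u = ?dn w" and w: "w \<in> {w \<in> weight_funs d n. \<forall>s\<in>D. w s \<noteq> 0}" by (rule imageE)
        have w_eq: "w = ?up u" unfolding u by (rule updn[symmetric]) (use w in blast)
        have "(\<Sum>s=1..d. w s * s) = (\<Sum>s=1..d. u s * s) + \<Sum>D" unfolding w_eq up ..
        then have "(\<Sum>s=1..d. u s * s) + \<Sum>D = n" using w by (simp add: weight_funs_def)
        moreover have "s \<in> {1..d}" if "u s \<noteq> 0" for s
          using that w unfolding u weight_funs_def by (cases "w s = 0") auto
        ultimately show "u \<in> weight_funs d (n - \<Sum>D)" by (auto simp: weight_funs_def)
      qed
    qed (use updn in auto)
    then show ?thesis using True by (simp add: bij_betw_same_card)
  next
    case False
    have "\<Sum>D \<le> n" if "w \<in> weight_funs d n" "\<forall>s\<in>D. w s \<noteq> 0" for w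
    proof -
      have w_eq: "w = ?up (?dn w)" by (rule updn[OF that(2), symmetric])
      have "(\<Sum>s=1..d. w s * s) = (\<Sum>s=1..d. ?dn w s * s) + \<Sum>D" by (subst w_eq) (rule up)
      then show ?thesis using that(1) by (simp add: weight_funs_def)
    qed
    then show ?thesis using False by (auto intro!: card_eq_0_iff[THEN iffD2])
  qed
qed

lemma weight_funs_Suc_eq: "weight_funs d n = {w \<in> weight_funs (Suc d) n. w (Suc d) = 0}"
proof -
  have sum: "(\<Sum>s=1..Suc d. w s * s) = (\<Sum>s=1..d. w s * s)" if "w (Suc d) = 0" for w :: "nat \<Rightarrow> nat"
    using that by simp
  show ?thesis
  proof (intro equalityI subsetI)
    fix w assume w: "w \<in> weight_funs d n"
    then have 0: "w (Suc d) = 0" by (auto simp: weight_funs_def)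
    have "s \<in> {1..Suc d}" if "w s \<noteq> 0" for s
    proof -
      have "s \<in> {1..d}" using w that by (simp add: weight_funs_def)
      then show ?thesis by simp
    qed
    then show "w \<in> {w \<in> weight_funs (Suc d) n. w (Suc d) = 0}"
      using w 0 sum[of w, OF 0] unfolding weight_funs_def by simp
  next
    fix w assume w: "w \<in> {w \<in> weight_funs (Suc d) n. w (Suc d) = 0}"
    then have 0: "w (Suc d) = 0" by simp
    have "s \<in> {1..d}" if "w s \<noteq> 0" for s
    proof -
      have "s \<in> {1..Suc d}" using w that by (simp add: weight_funs_def)
      moreover have "s \<noteq> Suc d" using 0 that by auto
      ultimately show ?thesis by simp
    qed
    then show "w \<in> weight_funs d n"
      using w sum[of w, OF 0] unfolding weight_funs_def by auto
  qed
qed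

text \<open>Induction on \<open>d\<close>: either \<open>w (Suc d) = 0\<close>, or 1 can be
  subtracted there. So the series for \<open>Suc d\<close> is the series for \<open>d\<close> plus
  \<open>fps_X ^ Suc d\<close> times itself.\<close>

lemma weight_funs_fps:
  "Abs_fps (\<lambda>n. of_nat (card (weight_funs d n))) = (\<Prod>j = 1..d. 1 / (1 - fps_X ^ j) :: 'a::field fps)"
proof (induction d)
  case 0
  have "weight_funs 0 n = (if n = 0 then {\<lambda>s. 0} else {})" for n
    by (auto simp: weight_funs_def)
  then have "Abs_fps (\<lambda>n. of_nat (card (weight_funs 0 n))) = (1 :: 'a fps)"
    by (intro fps_ext) simp
  then show ?case by simp
next
  case (Suc d)
  let ?G = "\<lambda>d. Abs_fps (\<lambda>n. of_nat (card (weight_funs d n))) :: 'a fps"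
  have step: "card (weight_funs (Suc d) n) =
      card (weight_funs d n) + (if Suc d \<le> n then card (weight_funs (Suc d) (n - Suc d)) else 0)" for n
  proof -
    let ?R = "{w \<in> weight_funs (Suc d) n. \<forall>s\<in>{Suc d}. w s \<noteq> 0}"
    have un: "weight_funs (Suc d) n = weight_funs d n \<union> ?R"
      unfolding weight_funs_Suc_eq[of d] by auto
    have disj: "weight_funs d n \<inter> ?R = {}"
      unfolding weight_funs_Suc_eq[of d] by auto
    have fin: "finite ?R"
      by (rule finite_subset[OF _ finite_weight_funs]) blast
    have "card (weight_funs (Suc d) n) = card (weight_funs d n \<union> ?R)"
      by (rule arg_cong[OF un])
    also have "\<dots> = card (weight_funs d n) + card ?R"
      by (rule card_Un_disjoint[OF finite_weight_funs fin disj])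
    finally have "card (weight_funs (Suc d) n) = card (weight_funs d n) + card ?R" .
    then show ?thesis using card_weight_funs_superset[of "{Suc d}" "Suc d" n] by simp
  qed
  have "?G (Suc d) * (1 - fps_X ^ Suc d) = ?G d"
  proof (rule fps_ext)
    fix n
    have "fps_nth (?G (Suc d) * (1 - fps_X ^ Suc d)) n =
        fps_nth (?G (Suc d)) n - fps_nth (fps_X ^ Suc d * ?G (Suc d)) n"
      by (simp only: left_diff_distrib mult_1_left fps_sub_nth mult.commute)
    also have "\<dots> = fps_nth (?G d) n"
      unfolding fps_X_power_mult_nth using step[of n] by (simp add: not_less)
    finally show "fps_nth (?G (Suc d) * (1 - fps_X ^ Suc d)) n = fps_nth (?G d) n" .
  qed
  then have "?G d * (1 / (1 - fps_X ^ Suc d)) = ?G (Suc d) * ((1 - fps_X ^ Suc d) * (1 / (1 - fps_X ^ Suc d)))"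
    by (simp only: mult.assoc[symmetric])
  also have "(1 - fps_X ^ Suc d) * (1 / (1 - fps_X ^ Suc d)) = (1 :: 'a fps)"
  proof -
    \<comment> \<open>The constant coefficient is 1, so the division is by a unit.\<close>
    have nz: "fps_nth (1 - fps_X ^ Suc d :: 'a fps) 0 \<noteq> 0" by simp
    show ?thesis unfolding fps_divide_unit[OF nz] using inverse_mult_eq_1'[OF nz] by simp
  qed
  finally show ?case using Suc.IH by (simp add: prod.atLeastLessThan_Suc)
qed

text \<open>Convergence of formal power series is coefficientwise: the coefficient of index
  \<open>n\<close> is constant on all finite parts of \<open>A\<close> that contain the finitely
  many elements of weight \<open>n\<close>.\<close>

lemma has_sum_fps_X_power:
  assumes "\<And>n. finite {x \<in> A. wt x = n}"
  shows "((\<lambda>x. fps_X ^ wt x) has_sum (Abs_fps (\<lambda>n. of_nat (card {x \<in> A. wt x = n})) :: 'a::comm_ring_1 fps)) A"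
  unfolding has_sum_def
proof (rule tendsto_fpsI)
  fix n
  let ?X = "{x \<in> A. wt x = n}"
  have "fps_nth (\<Sum>x\<in>Y. fps_X ^ wt x :: 'a fps) n = of_nat (card ?X)" if "finite Y" "?X \<subseteq> Y" "Y \<subseteq> A" for Y
  proof -
    have "fps_nth (\<Sum>x\<in>Y. fps_X ^ wt x :: 'a fps) n = (\<Sum>x\<in>Y. if wt x = n then 1 else 0)"
      by (auto simp: fps_sum_nth intro!: sum.cong)
    also have "\<dots> = (\<Sum>x\<in>?X. 1)"
      using that by (intro sum.mono_neutral_cong_right) auto
    finally show ?thesis by simp
  qed
  then show "\<forall>\<^sub>F Y in finite_subsets_at_top A. fps_nth (\<Sum>x\<in>Y. fps_X ^ wt x :: 'a fps) n =
      fps_nth (Abs_fps (\<lambda>n. of_nat (card {x \<in> A. wt x = n}))) n"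
    unfolding eventually_finite_subsets_at_top using assms[of n] by (intro exI[of _ ?X]) auto
qed

text \<open>Both counts satisfy the same recursion. Its side condition is inherited:
  \<open>Suc d \<in> S\<close> and \<open>p \<le> Suc d\<close> give
  \<open>d \<in> shift p S\<close>. For \<open>d = 0\<close> there is one flag and one
  permutation.\<close>

lemma card_flag_funs:
  assumes "S \<subseteq> {..d}" "d \<in> S"
  shows "card (flag_funs d S :: (nat \<Rightarrow> (nat \<Rightarrow> 'k::{field,finite}) set) set) = perm_count CARD('k) d S"
  using assms
proof (induction d arbitrary: S)
  case 0
  then have S: "S = {0}" by auto
  let ?f = "restrict (\<lambda>s. {\<lambda>i. 0 :: 'k}) {0::nat}"
  have V: "fun_space 0 = {\<lambda>i. 0 :: 'k}" by (auto simp: fun_space_def)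
  have "flag_funs 0 {0} = {?f}"
  proof (intro equalityI subsetI)
    fix f :: "nat \<Rightarrow> (nat \<Rightarrow> 'k) set" assume f: "f \<in> flag_funs 0 {0}"
    have "f 0 \<subseteq> {\<lambda>i. 0}" "(\<lambda>i. 0) \<in> f 0"
      using flag_funsD(2)[OF f, of 0] fun_subspaceD(4)[OF flag_funsD(1)[OF f, of 0]] V by auto
    then have "f 0 = {\<lambda>i. 0}" by blast
    then have "f = ?f" using flag_funsD(5)[OF f] by (intro extensionalityI[of _ "{0}"]) auto
    then show "f \<in> {?f}" by simp
  next
    fix f :: "nat \<Rightarrow> (nat \<Rightarrow> 'k) set" assume "f \<in> {?f}"
    then have f: "f = ?f" by simp
    show "f \<in> flag_funs 0 {0}"
      unfolding f
      by (rule flag_funsI) (use fun_subspace_fun_space[of 0, where 'a = 'k] V in simp_all)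
  qed
  then show ?case by (simp add: S perm_count_0)
next
  case (Suc d)
  have "card (flag_funs d (shift p S) :: (nat \<Rightarrow> (nat \<Rightarrow> 'k) set) set) = perm_count CARD('k) d (shift p S)"
    if "p \<in> S - {0}" for p
    using Suc.prems that by (intro Suc.IH) (auto simp: shift_def)
  then show ?case
    unfolding card_flag_funs_Suc[OF Suc.prems] perm_count_Suc[OF Suc.prems] by simp
qed

text \<open>After interchanging the sums, a fixed \<open>\<sigma>\<close> is paired with the
  \<open>w\<close> that are nonzero at all its descents. Removing 1 at each descent leaves all
  weight functions of \<open>n - perm_maj d \<sigma>\<close>, which is a coefficient of a product
  with \<open>fps_X ^ perm_maj d \<sigma>\<close>.\<close>

lemma perm_count_weight_funs_fps:
  "Abs_fps (\<lambda>n. of_nat (\<Sum>w\<in>weight_funs d n. perm_count q d (insert d {s. w s \<noteq> 0}))) =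
    inv_maj_fps q d * (\<Prod>j = 1..d. 1 / (1 - fps_X ^ j))"
proof (rule fps_ext)
  fix n
  let ?P = "{\<sigma>. \<sigma> permutes {1..d}}"
  let ?G = "Abs_fps (\<lambda>n. of_nat (card (weight_funs d n))) :: rat fps"
  have fin: "finite ?P" by (simp add: finite_permutations)
  have maj: "\<Sum>(descents d \<sigma>) = perm_maj d \<sigma>" for \<sigma> by (simp add: descents_def perm_maj_def)
  \<comment> \<open>Inserting \<open>d\<close>, as the count of flags requires, changes nothing for
    permutations, since descents are smaller than \<open>d\<close>.\<close>
  have des: "descents d \<sigma> \<subseteq> insert d X \<longleftrightarrow> descents d \<sigma> \<subseteq> X" for \<sigma> X
    by (auto simp: descents_def)
  have "(\<Sum>w\<in>weight_funs d n. perm_count q d (insert d {s. w s \<noteq> 0})) =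
      (\<Sum>w\<in>weight_funs d n. \<Sum>\<sigma>\<in>?P. if \<forall>s\<in>descents d \<sigma>. w s \<noteq> 0 then q ^ perm_inv d \<sigma> else 0)"
    unfolding perm_count_def des
    by (intro sum.cong refl sum.mono_neutral_cong_left fin) auto
  also have "\<dots> = (\<Sum>\<sigma>\<in>?P. \<Sum>w\<in>weight_funs d n. if \<forall>s\<in>descents d \<sigma>. w s \<noteq> 0 then q ^ perm_inv d \<sigma> else 0)"
    by (rule sum.swap)
  also have "\<dots> = (\<Sum>\<sigma>\<in>?P. \<Sum>w\<in>{w\<in>weight_funs d n. \<forall>s\<in>descents d \<sigma>. w s \<noteq> 0}. q ^ perm_inv d \<sigma>)"
    by (intro sum.cong refl sum.mono_neutral_cong_right finite_weight_funs) auto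
  also have "\<dots> = (\<Sum>\<sigma>\<in>?P. q ^ perm_inv d \<sigma> *
      (if perm_maj d \<sigma> \<le> n then card (weight_funs d (n - perm_maj d \<sigma>)) else 0))"
  proof (rule sum.cong[OF refl])
    fix \<sigma>
    have "descents d \<sigma> \<subseteq> {1..d}" by (auto simp: descents_def)
    from card_weight_funs_superset[OF this, of n]
    show "(\<Sum>w\<in>{w\<in>weight_funs d n. \<forall>s\<in>descents d \<sigma>. w s \<noteq> 0}. q ^ perm_inv d \<sigma>) =
      q ^ perm_inv d \<sigma> * (if perm_maj d \<sigma> \<le> n then card (weight_funs d (n - perm_maj d \<sigma>)) else 0)"
      unfolding maj by simp
  qed
  finally have "(of_nat (\<Sum>w\<in>weight_funs d n. perm_count q d (insert d {s. w s \<noteq> 0})) :: rat) =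
    (\<Sum>\<sigma>\<in>?P. of_nat q ^ perm_inv d \<sigma> *
      (if perm_maj d \<sigma> \<le> n then of_nat (card (weight_funs d (n - perm_maj d \<sigma>))) else 0))"
    by (simp add: if_distrib[of of_nat] cong: if_cong)
  moreover have "fps_nth (inv_maj_fps q d * (\<Prod>j = 1..d. 1 / (1 - fps_X ^ j))) n =
    (\<Sum>\<sigma>\<in>?P. of_nat q ^ perm_inv d \<sigma> *
      (if perm_maj d \<sigma> \<le> n then of_nat (card (weight_funs d (n - perm_maj d \<sigma>))) else 0))"
  proof -
    have "fps_nth (of_nat q ^ a * fps_X ^ m * ?G) n =
      of_nat q ^ a * (if m \<le> n then of_nat (card (weight_funs d (n - m))) else 0)" for a m
    proof -
      have eq: "of_nat q ^ a * fps_X ^ m * ?G = fps_const (of_nat q ^ a) * (fps_X ^ m * ?G)"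
        by (simp add: fps_of_nat[symmetric] fps_const_power[symmetric] mult.assoc del: fps_const_power)
      show ?thesis
        unfolding eq fps_mult_left_const_nth fps_X_power_mult_nth by (simp add: not_less)
    qed
    then show ?thesis
      unfolding weight_funs_fps[symmetric] inv_maj_fps_def sum_distrib_right fps_sum_nth by simp
  qed
  ultimately show "fps_nth (Abs_fps (\<lambda>n. of_nat (\<Sum>w\<in>weight_funs d n. perm_count q d (insert d {s. w s \<noteq> 0})))) n =
    fps_nth (inv_maj_fps q d * (\<Prod>j = 1..d. 1 / (1 - fps_X ^ j))) n" by simp
qed

subsection \<open>Weighted flags of the space of vectors\<close>

text \<open>Each vector has unique coordinates in a basis \<open>B\<close>, so vectors correspond to
  functions from \<open>B\<close> to the field. A finite carrier is a finite spanning set of itself,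
  which gives finite dimension.\<close>

lemma (in vectorspace) card_carrier_eq_power_dim:
  assumes fin: "finite (carrier V)"
  shows "card (carrier V) = card (carrier K) ^ dim"
proof -
  have "span (carrier V) = carrier V"
    using in_own_span[of "carrier V"] span_is_subset2[of "carrier V"] by blast
  then have "fin_dim" unfolding fin_dim_def using fin by blast
  then obtain B where B: "finite B" "basis B" using finite_basis_exists by blast
  have BV: "B \<subseteq> carrier V" using B(2) by (simp add: basis_def)
  have ex1: "\<exists>!a. a \<in> B \<rightarrow>\<^sub>E carrier K \<and> lincomb a B = v" if "v \<in> carrier V" for v
    using basis_criterion[OF B(1) BV] B(2) that by blast
  have closed: "lincomb a B \<in> carrier V" if "a \<in> B \<rightarrow>\<^sub>E carrier K" for a
    using that BV by (intro lincomb_closed) (auto simp: PiE_iff)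
  have "bij_betw (\<lambda>a. lincomb a B) (B \<rightarrow>\<^sub>E carrier K) (carrier V)"
  proof (rule bij_betw_imageI)
    show "inj_on (\<lambda>a. lincomb a B) (B \<rightarrow>\<^sub>E carrier K)"
      using ex1 closed by (intro inj_onI) blast
    show "(\<lambda>a. lincomb a B) ` (B \<rightarrow>\<^sub>E carrier K) = carrier V"
      using ex1 closed by blast
  qed
  from bij_betw_same_card[OF this] show ?thesis
    using card_funcsetE[OF B(1), of "carrier K"] dim_basis[OF B] by simp
qed

text \<open>Coordinates carry the counts over from functions to vectors; the inverse pads with zeros
  from index \<open>d\<close> on.\<close>

lemma bij_betw_vec: "bij_betw (vec d) (fun_space d) (carrier_vec d)"
proof (rule bij_betw_byWitness[where f' = "\<lambda>v i. if i < d then v $ i else 0"])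
  show "\<forall>x\<in>fun_space d. (\<lambda>i. if i < d then vec d x $ i else 0) = x"
    by (auto simp: fun_space_def)
qed (auto simp: fun_space_def)

lemma subspace_vec_image:
  fixes U :: "(nat \<Rightarrow> 'k::field) set"
  assumes U: "fun_subspace U"
  shows "VectorSpace.subspace class_ring (vec d ` U) (module_vec TYPE('k) d)"
proof -
  have add: "vec d x + vec d y = vec d (\<lambda>i. x i + y i)" for x y :: "nat \<Rightarrow> 'k" by (rule eq_vecI) auto
  have smult: "c \<cdot>\<^sub>v vec d x = vec d (\<lambda>i. c * x i)" for c and x :: "nat \<Rightarrow> 'k" by (rule eq_vecI) auto
  have zero: "0\<^sub>v d = vec d (\<lambda>i. 0 :: 'k)" by (rule eq_vecI) auto
  have "submodule class_ring (vec d ` U) (module_vec TYPE('k) d)"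
  proof (rule submodule.intro[OF vec_module])
    show "vec d ` U \<subseteq> carrier (module_vec TYPE('k) d)" by (auto simp: module_vec_simps)
    show "v \<oplus>\<^bsub>module_vec TYPE('k) d\<^esub> w \<in> vec d ` U" if "v \<in> vec d ` U" "w \<in> vec d ` U" for v w
      using that fun_subspaceD(2)[OF U] by (auto simp: module_vec_simps add)
    show "\<zero>\<^bsub>module_vec TYPE('k) d\<^esub> \<in> vec d ` U"
      using fun_subspaceD(4)[OF U] by (auto simp: module_vec_simps zero)
    show "c \<odot>\<^bsub>module_vec TYPE('k) d\<^esub> v \<in> vec d ` U" if "v \<in> vec d ` U" for c v
      using that fun_subspaceD(5)[OF U] by (auto simp: module_vec_simps smult)
  qed
  then show ?thesis by (intro subspace.intro vec_vs)
qed

lemma subspace_vec_preimage: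
  fixes W :: "'k::field vec set"
  assumes "VectorSpace.subspace class_ring W (module_vec TYPE('k) d)"
  shows "fun_subspace {x \<in> fun_space d. vec d x \<in> W}" "vec d ` {x \<in> fun_space d. vec d x \<in> W} = W"
proof -
  interpret submodule class_ring W "module_vec TYPE('k) d"
    using assms by (rule subspace.submod)
  have W: "W \<subseteq> carrier_vec d" using subset by (simp add: module_vec_simps)
  have add: "v + w \<in> W" if "v \<in> W" "w \<in> W" for v w using m_closed[OF that] by (simp add: module_vec_simps)
  have smult: "c \<cdot>\<^sub>v v \<in> W" if "v \<in> W" for c v using smult_closed[of c v] that by (simp add: module_vec_simps)
  have zero: "0\<^sub>v d \<in> W" using zero_closed by (simp add: module_vec_simps)
  show "fun_subspace {x \<in> fun_space d. vec d x \<in> W}"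
    unfolding fun_subspace_def
  proof (intro conjI ballI allI)
    have "vec d (\<lambda>i. 0) = (0\<^sub>v d :: 'k vec)" by (rule eq_vecI) auto
    then have "(\<lambda>i. 0) \<in> {x \<in> fun_space d. vec d x \<in> W}" using zero by (simp add: fun_space_def)
    then show "{x \<in> fun_space d. vec d x \<in> W} \<noteq> {}" by blast
    fix x y c assume xy: "x \<in> {x \<in> fun_space d. vec d x \<in> W}" "y \<in> {x \<in> fun_space d. vec d x \<in> W}"
    have "vec d (\<lambda>i. x i + c * y i) = vec d x + c \<cdot>\<^sub>v vec d y" by (rule eq_vecI) auto
    also have "\<dots> \<in> W" using xy by (intro add smult) auto
    finally have "vec d (\<lambda>i. x i + c * y i) \<in> W" .
    moreover have "(\<lambda>i. x i + c * y i) \<in> fun_space d"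
      using xy by (intro fun_subspaceD(1)[OF fun_subspace_fun_space]) auto
    ultimately show "(\<lambda>i. x i + c * y i) \<in> {x \<in> fun_space d. vec d x \<in> W}" by simp
  qed
  show "vec d ` {x \<in> fun_space d. vec d x \<in> W} = W"
  proof (intro equalityI subsetI)
    fix v assume v: "v \<in> W"
    then have "v \<in> vec d ` fun_space d" using W bij_betw_imp_surj_on[OF bij_betw_vec] by blast
    then show "v \<in> vec d ` {x \<in> fun_space d. vec d x \<in> W}" using v by auto
  qed auto
qed

lemma finite_carrier_vec: "finite (carrier_vec d :: 'k::{field,finite} vec set)"
  using bij_betw_finite[OF bij_betw_vec] finite_fun_space by blast

lemma card_subspace:
  fixes W :: "'k::{field,finite} vec set"
  assumes W: "VectorSpace.subspace class_ring W (module_vec TYPE('k) d)"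
  shows "card W = CARD('k) ^ subspace_dim class_ring (module_vec TYPE('k) d) W"
proof -
  interpret V: vectorspace class_ring "module_vec TYPE('k) d" by (rule vec_vs)
  interpret W: vectorspace class_ring "module_vec TYPE('k) d\<lparr>carrier := W\<rparr>"
    by (rule V.subspace_is_vs[OF W])
  have "W \<subseteq> carrier_vec d"
    using submodule.subset[OF V.is_module[OF W]] by (simp add: module_vec_simps)
  then have "finite W" using finite_carrier_vec finite_subset by blast
  then show ?thesis using W.card_carrier_eq_power_dim by (simp add: subspace_dim_def)
qed

text \<open>Only the support of \<open>w\<close> is read off. A value of \<open>f\<close> at
  \<open>d\<close> with \<open>w d = 0\<close> is auxiliary and does not enter the weighted
  flag.\<close>

definition weighted_flag_of ::
  "nat \<Rightarrow> (nat \<Rightarrow> nat) \<Rightarrow> (nat \<Rightarrow> (nat \<Rightarrow> 'k) set) \<Rightarrow> 'k vec set list \<times> nat list" where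
  "weighted_flag_of d w f =
    (let L = sorted_list_of_set {s. w s \<noteq> 0} in (map (\<lambda>s. vec d ` f s) L, map w L))"

context

  \<comment> \<open>Weighted flags as pairs of a weight function and a flag function\<close>
  fixes d :: nat and ty :: "'k::{field,finite} itself"
begin

abbreviation (input) "vdim \<equiv> subspace_dim class_ring (module_vec TYPE('k) d)"
abbreviation (input) "is_subsp W \<equiv> VectorSpace.subspace class_ring W (module_vec TYPE('k) d)"

lemma vdim_eq_iff:
  assumes "is_subsp W" shows "vdim W = s \<longleftrightarrow> card W = CARD('k) ^ s"
  unfolding card_subspace[OF assms] by (rule power_inject_exp[OF one_less_card_field, symmetric])

lemma card_vec_image: "U \<subseteq> (fun_space d :: (nat \<Rightarrow> 'k) set) \<Longrightarrow> card (vec d ` U) = card U"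
  by (intro card_image inj_on_subset[OF bij_betw_imp_inj_on[OF bij_betw_vec]])

lemma vdim_vec_image:
  assumes "f \<in> flag_funs d S" "s \<in> S"
  shows "is_subsp (vec d ` f s)" "vdim (vec d ` f s) = s"
proof -
  note F = flag_funsD[OF assms(1)]
  show sub: "is_subsp (vec d ` f s)" by (rule subspace_vec_image[OF F(1)[OF assms(2)]])
  show "vdim (vec d ` f s) = s"
    unfolding vdim_eq_iff[OF sub] card_vec_image[OF F(2)[OF assms(2)]] by (rule F(3)[OF assms(2)])
qed

lemma weighted_flag_of_weight:
  assumes w: "{s. w s \<noteq> 0} \<subseteq> {1..d}" and f: "f \<in> flag_funs d (insert d {s. w s \<noteq> 0})"
  shows "flag_weight class_ring (module_vec TYPE('k) d) (weighted_flag_of d w f) = (\<Sum>s=1..d. w s * s)"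
proof -
  let ?S = "{s. w s \<noteq> 0}"
  define L where "L = sorted_list_of_set ?S"
  have fin: "finite ?S" using w finite_subset by blast
  then have L: "set L = ?S" "distinct L" by (simp_all add: L_def)
  have dim: "vdim (vec d ` f s) = s" if "s \<in> set L" for s
    using vdim_vec_image(2)[OF f, of s] that L(1) by blast
  have "flag_weight class_ring (module_vec TYPE('k) d) (weighted_flag_of d w f) =
      (\<Sum>i<length L. w (L ! i) * L ! i)"
    unfolding flag_weight_def weighted_flag_of_def Let_def L_def[symmetric]
    by (rule sum.cong) (simp_all add: dim)
  also have "\<dots> = (\<Sum>s\<in>set L. w s * s)"
    using sum.reindex_bij_betw[OF bij_betw_nth[OF L(2) refl refl], of "\<lambda>s. w s * s"] .
  also have "\<dots> = (\<Sum>s=1..d. w s * s)"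
    unfolding L(1) using w by (intro sum.mono_neutral_left) auto
  finally show ?thesis .
qed

lemma weighted_flag_of_in_weighted_flags:
  assumes w: "{s. w s \<noteq> 0} \<subseteq> {1..d}" and f: "f \<in> flag_funs d (insert d {s. w s \<noteq> 0})"
  shows "weighted_flag_of d w f \<in> weighted_flags class_ring (module_vec TYPE('k) d)"
proof -
  let ?S = "{s. w s \<noteq> 0}"
  define L where "L = sorted_list_of_set ?S"
  have fin: "finite ?S" using w finite_subset by blast
  then have L: "set L = ?S" "sorted_wrt (<) L" by (simp_all add: L_def)
  have S: "s \<in> insert d ?S" if "s \<in> set L" for s using that L(1) by blast
  have range: "0 < s \<and> s \<le> d" if "s \<in> set L" for s using that L(1) w by auto
  note P = vdim_vec_image[OF f S]
  have "sorted_wrt (\<lambda>s t. vec d ` f s \<subset> vec d ` f t \<and> vdim (vec d ` f s) < vdim (vec d ` f t)) L"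
  proof (rule sorted_wrt_mono_rel[OF _ L(2)])
    fix s t assume st: "s \<in> set L" "t \<in> set L" "s < t"
    have "vec d ` f s \<subseteq> vec d ` f t"
      using flag_funsD(4)[OF f S[OF st(1)] S[OF st(2)]] st(3) by (intro image_mono) simp
    moreover have less: "vdim (vec d ` f s) < vdim (vec d ` f t)" using P st by simp
    moreover from less have "vec d ` f s \<noteq> vec d ` f t" by auto
    ultimately show "vec d ` f s \<subset> vec d ` f t \<and> vdim (vec d ` f s) < vdim (vec d ` f t)" by blast
  qed
  moreover have "vectorspace.dim class_ring (module_vec TYPE('k) d) = d" by (rule vec_space.dim_is_n)
  ultimately have "map (\<lambda>s. vec d ` f s) L \<in> flags class_ring (module_vec TYPE('k) d)"
    unfolding flags_def using P range by (simp add: sorted_wrt_map)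
  then show ?thesis
    unfolding weighted_flags_def weighted_flag_of_def Let_def L_def[symmetric] using L(1) by simp
qed

text \<open>The dimensions of the members recover the support of the weight function. Over this
  common index list the entries can be compared one by one; outside the support the weights are
  0.\<close>

lemma weighted_flag_of_inj:
  assumes w: "{s. w s \<noteq> 0} \<subseteq> {1..d}" and f: "f \<in> flag_funs d (insert d {s. w s \<noteq> 0})"
    and w': "{s. w' s \<noteq> 0} \<subseteq> {1..d}" and f': "f' \<in> flag_funs d (insert d {s. w' s \<noteq> 0})"
    and eq: "weighted_flag_of d w f = (weighted_flag_of d w' f' :: 'k vec set list \<times> nat list)"
  shows "w = w' \<and> f = f'"
proof -
  let ?L = "\<lambda>w. sorted_list_of_set {s. w s \<noteq> (0::nat)}"
  have fin: "finite {s. w s \<noteq> 0}" "finite {s. w' s \<noteq> 0}" using w w' finite_subset by blast+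
  have dims: "map vdim (fst (weighted_flag_of d u g)) = ?L u"
    if u: "finite {s. u s \<noteq> 0}" and g: "g \<in> flag_funs d (insert d {s. u s \<noteq> 0})" for u g
  proof -
    have "(vdim \<circ> (\<lambda>s. vec d ` g s)) s = s" if s: "s \<in> set (?L u)" for s
      using vdim_vec_image(2)[OF g, of s] s u by simp
    then show ?thesis unfolding weighted_flag_of_def Let_def fst_conv map_map by (rule map_idI)
  qed
  have L: "?L w = ?L w'" using dims[OF fin(1) f] dims[OF fin(2) f'] unfolding eq by (rule trans[OF sym])
  have S: "{s. w s \<noteq> 0} = {s. w' s \<noteq> 0}"
    using arg_cong[OF L, of set] unfolding set_sorted_list_of_set[OF fin(1)] set_sorted_list_of_set[OF fin(2)] .
  have ws: "\<forall>s\<in>{s. w s \<noteq> 0}. w s = w' s"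
    using arg_cong[OF eq, of snd]
    unfolding weighted_flag_of_def Let_def snd_conv L[symmetric] map_eq_conv set_sorted_list_of_set[OF fin(1)] .
  have fs: "\<forall>s\<in>{s. w s \<noteq> 0}. vec d ` f s = vec d ` f' s"
    using arg_cong[OF eq, of fst]
    unfolding weighted_flag_of_def Let_def fst_conv L[symmetric] map_eq_conv set_sorted_list_of_set[OF fin(1)] .
  have "w s = w' s" for s
  proof (cases "s \<in> {s. w s \<noteq> 0}")
    case True
    then show ?thesis using ws by blast
  next
    case False
    then have "s \<notin> {s. w' s \<noteq> 0}" unfolding S .
    then show ?thesis using False by simp
  qed
  then have "w = w'" by (rule ext)
  have f'': "f' \<in> flag_funs d (insert d {s. w s \<noteq> 0})" using f' unfolding S .
  \<comment> \<open>The auxiliary value at \<open>d\<close> is the whole space by cardinality, so it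
    carries no information that the weighted flag could lose.\<close>
  have top: "g d = fun_space d" if "g \<in> flag_funs d (insert d X)" for g :: "nat \<Rightarrow> (nat \<Rightarrow> 'k) set" and X
    using flag_funsD(2,3)[OF that, of d] by (intro card_subset_eq finite_fun_space) (simp_all add: card_fun_space)
  have "f s = f' s" if s: "s \<in> insert d {s. w s \<noteq> 0}" for s
  proof (cases "s = d")
    case True then show ?thesis using top[OF f] top[OF f''] by simp
  next
    case False
    then have "vec d ` f s = vec d ` f' s" using fs s by blast
    then show ?thesis
      using inj_on_image_eq_iff[OF bij_betw_imp_inj_on[OF bij_betw_vec]
          flag_funsD(2)[OF f s] flag_funsD(2)[OF f'' s]] by simp
  qed
  then have "f = f'" by (rule extensionalityI[OF flag_funsD(5)[OF f] flag_funsD(5)[OF f'']])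
  with \<open>w = w'\<close> show ?thesis by simp
qed

text \<open>Dimensions strictly increase along a flag, so its members and weights can be indexed by
  dimension instead of by position.\<close>

lemma weighted_flag_of_surj:
  assumes F: "F \<in> weighted_flags class_ring (module_vec TYPE('k) d)"
  obtains w f where "{s. w s \<noteq> 0} \<subseteq> {1..d}" "f \<in> flag_funs d (insert d {s. w s \<noteq> 0})"
    "F = weighted_flag_of d w f"
proof -
  obtain Vs ws where F_eq: "F = (Vs, ws)" by (cases F)
  have flag: "Vs \<in> flags class_ring (module_vec TYPE('k) d)" and len: "length ws = length Vs"
    and pos: "\<forall>w\<in>set ws. 0 < w"
    using F unfolding F_eq weighted_flags_def by simp_all
  have dV: "vectorspace.dim class_ring (module_vec TYPE('k) d) = d" by (rule vec_space.dim_is_n)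
  have Vs: "\<forall>W\<in>set Vs. is_subsp W \<and> 0 < vdim W \<and> vdim W \<le> d"
    and chain: "sorted_wrt (\<lambda>U W. U \<subset> W \<and> vdim U < vdim W) Vs"
    using flag unfolding flags_def dV mem_Collect_eq by (rule conjunct1, rule conjunct2)
  define D where "D = map vdim Vs"
  define S where "S = set D"
  have lenD: "length D = length Vs" by (simp add: D_def)
  have sorted: "sorted_wrt (<) D"
    unfolding D_def sorted_wrt_map by (rule sorted_wrt_mono_rel[OF _ chain]) (erule conjunct2)
  have dist: "distinct D" and sorted': "List.sorted D" using sorted unfolding strict_sorted_iff
    by (rule conjunct2, rule conjunct1)
  have S: "S \<subseteq> {1..d}"
  proof
    fix s assume "s \<in> S"
    then obtain W where "W \<in> set Vs" "s = vdim W" unfolding S_def D_def set_map by (rule imageE)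
    then show "s \<in> {1..d}" using bspec[OF Vs] by (simp add: Suc_le_eq)
  qed
  have L: "sorted_list_of_set S = D"
    unfolding S_def by (rule sorted_list_of_set.idem_if_sorted_distinct[OF sorted' dist])
  \<comment> \<open>The position in the list of the member of a given dimension.\<close>
  define idx where "idx = inv_into {..<length D} ((!) D)"
  have inj: "inj_on ((!) D) {..<length D}" by (rule inj_on_nth[OF dist]) simp
  have idx_nth: "idx (D ! i) = i" if "i < length D" for i
    unfolding idx_def by (rule inv_into_f_f[OF inj]) (simp add: that)
  have idx: "idx s < length D \<and> D ! idx s = s" if s: "s \<in> S" for s
  proof -
    obtain i where i: "i < length D" "D ! i = s" using s unfolding S_def in_set_conv_nth by blast
    have "idx s = i" using idx_nth[OF i(1)] unfolding i(2) .
    then show ?thesis using i by simp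
  qed
  define w where "w = (\<lambda>s. if s \<in> S then ws ! idx s else 0)"
  \<comment> \<open>If \<open>d\<close> is not the dimension of a member, the whole space is
    supplied there.\<close>
  define f where "f = restrict (\<lambda>s. if s \<in> S then {x \<in> fun_space d. vec d x \<in> Vs ! idx s} else fun_space d) (insert d S)"
  have supp: "{s. w s \<noteq> 0} = S"
  proof -
    have "ws ! idx s \<noteq> 0" if "s \<in> S" for s
    proof -
      have "ws ! idx s \<in> set ws" using idx[OF that] len lenD by simp
      then show ?thesis using pos by auto
    qed
    then show ?thesis by (auto simp: w_def)
  qed
  have fS: "f s = {x \<in> fun_space d. vec d x \<in> Vs ! idx s}" if "s \<in> S" for s using that by (simp add: f_def)
  have ftop: "f d = fun_space d" if "d \<notin> S" using that by (simp add: f_def)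
  have Vi: "is_subsp (Vs ! idx s)" "vdim (Vs ! idx s) = s" if "s \<in> S" for s
  proof -
    have i: "idx s < length Vs" "D ! idx s = s" using idx[OF that] lenD by simp_all
    show "is_subsp (Vs ! idx s)" using Vs i(1) by simp
    show "vdim (Vs ! idx s) = s" using i(2) nth_map[OF i(1), of vdim] unfolding D_def by simp
  qed
  have image: "vec d ` f s = Vs ! idx s" if "s \<in> S" for s
    unfolding fS[OF that] by (rule subspace_vec_preimage(2)[OF Vi(1)[OF that]])
  have sub: "f s \<subseteq> fun_space d" if "s \<in> insert d S" for s
    using that fS ftop by (cases "s \<in> S") auto
  have "f \<in> flag_funs d (insert d S)"
  proof (rule flag_funsI)
    show "f \<in> extensional (insert d S)" by (simp add: f_def)
    fix s assume s: "s \<in> insert d S"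
    show "f s \<subseteq> fun_space d" by (rule sub[OF s])
    show "fun_subspace (f s)"
    proof (cases "s \<in> S")
      case True
      then show ?thesis unfolding fS[OF True] by (intro subspace_vec_preimage(1) Vi(1))
    next
      case False
      then show ?thesis using s ftop fun_subspace_fun_space by auto
    qed
    show "card (f s) = CARD('k) ^ s"
    proof (cases "s \<in> S")
      case True
      have "card (f s) = card (Vs ! idx s)" using card_vec_image[OF sub[OF s]] image[OF True] by simp
      then show ?thesis using card_subspace[OF Vi(1)[OF True]] unfolding Vi(2)[OF True] by simp
    next
      case False
      then show ?thesis using s ftop card_fun_space by auto
    qed
    fix t assume t: "t \<in> insert d S" "s \<le> t"
    show "f s \<subseteq> f t"
    proof (cases "t \<in> S")
      case False
      then show ?thesis using t ftop sub[OF s] by auto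
    next
      case tS: True
      \<comment> \<open>If \<open>s\<close> were the added index \<open>d\<close>, then
        \<open>s \<le> t \<le> d\<close> would give \<open>s = t\<close>, which is in
        \<open>S\<close>.\<close>
      then have sS: "s \<in> S" using s t S by auto
      have "Vs ! idx s \<subseteq> Vs ! idx t"
      proof (cases "idx s < idx t")
        case True
        then show ?thesis using sorted_wrt_nth_less[OF chain True] idx[OF tS] lenD by auto
      next
        case False
        have "\<not> idx t < idx s"
        proof
          assume "idx t < idx s"
          from sorted_wrt_nth_less[OF sorted this] idx[OF sS] idx[OF tS] t(2) show False by simp
        qed
        then show ?thesis using False by simp
      qed
      then show ?thesis unfolding fS[OF sS] fS[OF tS] by blast
    qed
  qed
  moreover have "F = weighted_flag_of d w f"
  proof -
    have "map (\<lambda>s. vec d ` f s) D = Vs"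
    proof (rule nth_equalityI)
      fix i assume i: "i < length (map (\<lambda>s. vec d ` f s) D)"
      then have "D ! i \<in> S" by (simp add: S_def)
      from image[OF this] show "map (\<lambda>s. vec d ` f s) D ! i = Vs ! i" using i idx_nth by simp
    qed (simp add: lenD)
    moreover have "map w D = ws"
    proof (rule nth_equalityI)
      fix i assume i: "i < length (map w D)"
      then have "D ! i \<in> S" by (simp add: S_def)
      then show "map w D ! i = ws ! i" using i idx_nth by (simp add: w_def)
    qed (simp add: lenD len)
    ultimately show ?thesis unfolding F_eq weighted_flag_of_def Let_def supp L by simp
  qed
  ultimately show ?thesis using that[of w f] S supp by simp
qed

text \<open>The map \<open>weighted_flag_of\<close> is a bijection from the pairs
  \<open>(w, f)\<close> with \<open>w\<close> of total weight \<open>n\<close>; for each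
  \<open>w\<close> the number of \<open>f\<close> is the permutation count with descents in the
  support of \<open>w\<close>.\<close>

lemma card_weighted_flags_of_weight:
  fixes n
  defines "A \<equiv> {F \<in> weighted_flags class_ring (module_vec TYPE('k) d).
    flag_weight class_ring (module_vec TYPE('k) d) F = n}"
  shows "finite A"
    and "card A = (\<Sum>w\<in>weight_funs d n. perm_count CARD('k) d (insert d {s. w s \<noteq> 0}))"
proof -
  let ?S = "\<lambda>w. insert d {s. w s \<noteq> (0::nat)}"
  let ?X = "Sigma (weight_funs d n) (\<lambda>w. flag_funs d (?S w) :: (nat \<Rightarrow> (nat \<Rightarrow> 'k) set) set)"
  have supp: "{s. w s \<noteq> 0} \<subseteq> {1..d}" if "w \<in> weight_funs d n" for w
    using that unfolding weight_funs_def by blast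
  have finS: "finite (?S w)" if "w \<in> weight_funs d n" for w
    using finite_subset[OF supp[OF that]] by simp
  have fin: "finite ?X" by (intro finite_SigmaI finite_weight_funs finite_flag_funs finS)
  have bij: "bij_betw (\<lambda>(w, f). weighted_flag_of d w f) ?X A"
  proof (rule bij_betw_imageI)
    show "inj_on (\<lambda>(w, f). weighted_flag_of d w f) ?X"
    proof (rule inj_onI)
      fix x y assume "x \<in> ?X" "y \<in> ?X"
        and eq: "(\<lambda>(w, f). weighted_flag_of d w f) x = (\<lambda>(w, f). weighted_flag_of d w f) y"
      then obtain w f w' f' where x: "x = (w, f)" "w \<in> weight_funs d n" "f \<in> flag_funs d (?S w)"
        and y: "y = (w', f')" "w' \<in> weight_funs d n" "f' \<in> flag_funs d (?S w')"
        by (elim SigmaE)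
      have "weighted_flag_of d w f = weighted_flag_of d w' f'" using eq unfolding x(1) y(1) by simp
      then show "x = y"
        using weighted_flag_of_inj[OF supp[OF x(2)] x(3) supp[OF y(2)] y(3)] x(1) y(1) by simp
    qed
    show "(\<lambda>(w, f). weighted_flag_of d w f) ` ?X = A"
    proof (intro equalityI subsetI)
      fix F assume "F \<in> (\<lambda>(w, f). weighted_flag_of d w f) ` ?X"
      then obtain x where x: "F = (\<lambda>(w, f). weighted_flag_of d w f) x" "x \<in> ?X" by (rule imageE)
      from x(2) obtain w f where wf: "x = (w, f)" "w \<in> weight_funs d n" "f \<in> flag_funs d (?S w)"
        by (rule SigmaE)
      have "F = weighted_flag_of d w f" using x(1) wf(1) by simp
      then show "F \<in> A"
        using weighted_flag_of_weight[OF supp[OF wf(2)] wf(3)] wf(2)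
          weighted_flag_of_in_weighted_flags[OF supp[OF wf(2)] wf(3)]
        by (simp add: A_def weight_funs_def)
    next
      fix F assume F: "F \<in> A"
      then have "F \<in> weighted_flags class_ring (module_vec TYPE('k) d)" by (simp add: A_def)
      then obtain w f where wf: "{s. w s \<noteq> 0} \<subseteq> {1..d}" "f \<in> flag_funs d (?S w)" "F = weighted_flag_of d w f"
        by (rule weighted_flag_of_surj)
      have "(\<Sum>s=1..d. w s * s) = n" using weighted_flag_of_weight[OF wf(1,2)] F wf(3) by (simp add: A_def)
      then have "w \<in> weight_funs d n" using wf(1) by (auto simp: weight_funs_def)
      then have "(w, f) \<in> ?X" using wf(2) unfolding mem_Sigma_iff by (rule conjI)
      then show "F \<in> (\<lambda>(w, f). weighted_flag_of d w f) ` ?X"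
        using wf(3) by (intro image_eqI[of _ _ "(w, f)"]) simp_all
    qed
  qed
  show "finite A" using bij_betw_finite[OF bij] fin by blast
  have "card A = card ?X" using bij_betw_same_card[OF bij] by simp
  also have "\<dots> = (\<Sum>w\<in>weight_funs d n. card (flag_funs d (?S w) :: (nat \<Rightarrow> (nat \<Rightarrow> 'k) set) set))"
    by (intro card_SigmaI finite_weight_funs ballI finite_flag_funs finS)
  also have "\<dots> = (\<Sum>w\<in>weight_funs d n. perm_count CARD('k) d (?S w))"
  proof (rule sum.cong[OF refl])
    fix w assume "w \<in> weight_funs d n"
    from supp[OF this] have "?S w \<subseteq> {..d}" by auto
    then show "card (flag_funs d (?S w) :: (nat \<Rightarrow> (nat \<Rightarrow> 'k) set) set) = perm_count CARD('k) d (?S w)"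
      by (rule card_flag_funs) simp
  qed
  finally show "card A = (\<Sum>w\<in>weight_funs d n. perm_count CARD('k) d (?S w))" .
qed

end

theorem theorem2p2:
  fixes q d :: nat
  assumes "primepow q"
    and "card (UNIV :: ('k :: {field, finite}) set) = q"
  shows "((\<lambda>F. fps_X ^ flag_weight class_ring (module_vec TYPE('k) d) F) has_sum
           (inv_maj_fps q d * (\<Prod>j = 1..d. 1 / (1 - fps_X ^ j))))
         (weighted_flags class_ring (module_vec TYPE('k) d))"
  \<comment> \<open>Group the weighted flags by weight; each weight occurs finitely often, and the
    series of these numbers is the product computed above.\<close>
  using has_sum_fps_X_power[OF card_weighted_flags_of_weight(1)[where 'k = 'k and d = d], where 'a = rat]
  unfolding card_weighted_flags_of_weight(2) assms(2) perm_count_weight_funs_fps .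

end
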